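(* For $i=1,\ldots,\varrho$ and $j=1,\ldots,\varsigma$, let $\{A_{\mathbf n,ij}=[a_{\mathbf i\mathbf j,ij}^{(\mathbf n)}]_{\mathbf i,\mathbf j=\mathbf 1}^{\mathbf n}\}_n$ be a $d$-level $(r_i,s_j)$-block matrix-sequence (all with the same sequence of level orders $\{\mathbf n=\mathbf n(n)\}_n$) and let $\kappa_{ij}:[0,1]^d\times[-\pi,\pi]^d\to\mathbb C^{r_i\times s_j}$ be measurable. Let $r=\sum_{i=1}^\varrho r_i$, $s=\sum_{j=1}^\varsigma s_j$, define the $d$-level $(r,s)$-block matrix $A_{\mathbf n}=\bigl[\,[a_{\mathbf i\mathbf j,ij}^{(\mathbf n)}]_{i=1,\ldots,\varrho}^{j=1,\ldots,\varsigma}\,\bigr]_{\mathbf i,\mathbf j=\mathbf 1}^{\mathbf n}$ (whose $(\mathbf i,\mathbf j)$ block is the $r\times s$ block matrix with blocks $a_{\mathbf i\mathbf j,ij}^{(\mathbf n)}$) and the $r\times s$ matrix-valued function $\kappa=[\kappa_{ij}]_{i=1,\ldots,\varrho}^{j=1,\ldots,\varsigma}$. Then $$\{A_{\mathbf n}\}_n\sim_{\rm GLT}\kappa\iff\{A_{\mathbf n,ij}\}_n\sim_{\rm GLT}\kappa_{ij}\text{ for all }i=1,\ldots,\varrho\text{ and }j=1,\ldots,\varsigma.$$ Moreover, if $B_{\mathbf n}=[A_{\mathbf n,ij}]_{i=1,\ldots,\varrho}^{j=1,\ldots,\varsigma}$, then $$\Bigl(P_{r,N(\mathbf n)}\operatorname*{diag}_{i=1,\ldots,\varrho}P_{r_i,N(\mathbf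 n)}^T\Bigr)\,B_{\mathbf n}\,\Bigl(P_{s,N(\mathbf n)}\operatorname*{diag}_{j=1,\ldots,\varsigma}P_{s_j,N(\mathbf n)}^T\Bigr)^T=A_{\mathbf n}.$$
   Context: Permutation matrices. For $k_1,k_2\in\mathbb N$, with $\mathbf e_i^{(k_2)}$ the canonical basis (column) vectors of $\mathbb C^{k_2}$, $P_{k_1,k_2}=\sum_{i=1}^{k_2}\mathbf e_i^{(k_2)}\otimes I_{k_1}\otimes(\mathbf e_i^{(k_2)})^T$, i.e. the $k_1k_2\times k_1k_2$ matrix obtained by stacking vertically $I_{k_1}\otimes(\mathbf e_1^{(k_2)})^T,\dots,I_{k_1}\otimes(\mathbf e_{k_2}^{(k_2)})^T$; here $\otimes$ is the Kronecker product $X\otimes Y=[x_{ij}Y]_{i,j}$. $\operatorname{diag}$ of a list of matrices is the block diagonal matrix. Conventions. A $d$-index is a vector in $\mathbb Z^d$. For $\mathbf n\in\mathbb N^d$ ($\mathbb N=\{1,2,\dots\}$) put $N(\mathbf n)=\prod_{i=1}^d n_i$; $\mathbf n\to\infty$ means $\min_i n_i\to\infty$. Operations and inequalities between $d$-indices are componentwise, $\mathbf 1=(1,\dots,1)$, and $\mathbf i=\mathbf 1,\dots,\mathbf n$ means that $\mathbf i$ ranges over $\{\mathbf i\in\mathbb Z^d:\mathbf 1\le\mathbf i\le\mathbf n\}$ in lexicographic order. A $d$-level $(r,s)$-block matrix with level orders $\mathbf n$ is a matrix $X=[x_{\mathbf i\mathbf j}]_{\mathbf i,\mathbf j=\mathbf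 1}^{\mathbf n}$ of size $N(\mathbf n)r\times N(\mathbf n)s$ whose entries $x_{\mathbf i\mathbf j}$ are $r\times s$ complex blocks. A $d$-level $(r,s)$-block matrix-sequence is a sequence $\{A_{\mathbf n}\}_n$ where $n$ varies in an infinite subset of $\mathbb N$, $\mathbf n=\mathbf n(n)\in\mathbb N^d$ satisfies $\mathbf n\to\infty$ as $n\to\infty$, and $A_{\mathbf n}$ is an $N(\mathbf n)r\times N(\mathbf n)s$ matrix (regarded as a $d$-level $(r,s)$-block matrix); "$s$-block" means "$(s,s)$-block". Matrix-valued functions are measurable, continuous a.e., convergent in measure, etc. if their components are (Lebesgue measure); $I_s$ is the $s\times s$ identity. Toeplitz and sampling matrices. For $f:[-\pi,\pi]^d\to\mathbb C^{r\times s}$ in $L^1$, with Fourier coefficients $f_{\mathbf k}=(2\pi)^{-d}\int_{[-\pi,\pi]^d}f(\boldsymbol\theta)e^{-\mathrm i\mathbf k\cdot\boldsymbol\theta}d\boldsymbol\theta$, let $T_{\mathbf n}(f)=[f_{\mathbf i-\mathbf j}]_{\mathbf i,\mathbf j=\mathbf 1}^{\mathbf n}$. For $a:[0,1]^d\to\mathbb C^{r\times s}$ let $D_{\mathbf n}(a)$ be the block diagonal matrix $\mathrm{diag}_{\mathbf i=\mathbf 1,\dots,\mathbf n}\,a(\mathbf i/\mathbf n)$. A.c.s. If $A_n$ and $B_{n,m}$ are $d_n\times e_n$ matrices, $\{B_{n,m}\}_n\xrightarrow{\rm a.c.s.}\{A_n\}_n$ (as $m\to\infty$) means: for every $m$ there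 is $n_m$ such that for $n\ge n_m$, $A_n=B_{n,m}+R_{n,m}+N_{n,m}$ with $\mathrm{rank}(R_{n,m})\le c(m)\min(d_n,e_n)$ and $\|N_{n,m}\|\le\omega(m)$ (spectral norm), where $n_m,c(m),\omega(m)$ depend only on $m$ and $c(m),\omega(m)\to0$ as $m\to\infty$. Square GLT sequences. For a $d$-level $s$-block matrix-sequence $\{A_{\mathbf n}\}_n$ and a measurable $\kappa:[0,1]^d\times[-\pi,\pi]^d\to\mathbb C^{s\times s}$, one writes $\{A_{\mathbf n}\}_n\sim_{\rm GLT}\kappa$ ("$\{A_{\mathbf n}\}_n$ is a $d$-level $s$-block GLT sequence with symbol $\kappa$") if (this characterization is equivalent to the original definition) for every $m$ there are finitely many functions $a_{i,m}\in C^\infty([0,1]^d)$ (complex-valued) and trigonometric monomials $f_{i,m}\in\{e^{\mathrm i\mathbf j\cdot\boldsymbol\theta}E_{\alpha\beta}^{(s)}:\mathbf j\in\mathbb Z^d,1\le\alpha,\beta\le s\}$, $i=1,\dots,N_m$, where $E^{(s)}_{\alpha\beta}$ is the $s\times s$ matrix with $1$ in position $(\alpha,\beta)$ and $0$ elsewhere, such that $\sum_{i=1}^{N_m}a_{i,m}(\mathbf x)f_{i,m}(\boldsymbol\theta)\to\kappa(\mathbf x,\boldsymbol\theta)$ a.e. as $m\to\infty$ and $\{\sum_{i=1}^{N_m}D_{\mathbf n}(a_{i,m}I_s)T_{\mathbf n}(f_{i,m})\}_n\xrightarrow{\rm a.c.s.}\{A_{\mathbf n}\}_n$. Extension operator.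 For $t\ge\max(r,s)$ and $x\in\mathbb C^{r\times s}$, $E_{r,s}^t(x)=\begin{bmatrix}x&O\\O&O\end{bmatrix}\in\mathbb C^{t\times t}$; for a $d$-level $(r,s)$-block matrix $X=[x_{\mathbf i\mathbf j}]$, $E_{r,s}^t(X)=[E_{r,s}^t(x_{\mathbf i\mathbf j})]_{\mathbf i,\mathbf j=\mathbf 1}^{\mathbf n}$ (a $d$-level $t$-block matrix). Rectangular GLT sequences. For a $d$-level $(r,s)$-block matrix-sequence $\{A_{\mathbf n}\}_n$ and a measurable $\kappa:[0,1]^d\times[-\pi,\pi]^d\to\mathbb C^{r\times s}$, one writes $\{A_{\mathbf n}\}_n\sim_{\rm GLT}\kappa$ ("$\{A_{\mathbf n}\}_n$ is a $d$-level $(r,s)$-block GLT sequence with symbol $\kappa$") if $\{E_{r,s}^t(A_{\mathbf n})\}_n\sim_{\rm GLT}E_{r,s}^t(\kappa)$ in the square sense for all $t\ge\max(r,s)$; equivalently, for some $t\ge\max(r,s)$. For $r=s$ this agrees with the square notion. *)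

theory Defs
  imports
    "HOL-Analysis.Analysis"
    "Jordan_Normal_Form.Matrix"
    "Jordan_Normal_Form.DL_Rank"
begin

text \<open>
  The number of levels is \<open>d = CARD('d)\<close> for an index type \<open>'d :: {finite, linorder}\<close>; the linear
  order on \<open>'d\<close> is the order of the levels.  A \<open>d\<close>-index with nonnegative entries is a function
  \<open>'d \<Rightarrow> nat\<close>, a general one is a function \<open>'d \<Rightarrow> int\<close>, and points of \<open>[0,1]\<^sup>d\<close> and
  \<open>[-\<pi>,\<pi>]\<^sup>d\<close> live in \<open>real ^ 'd\<close>.  Matrices of variable size are those of
  \<^theory>\<open>Jordan_Normal_Form.Matrix\<close>, whose rows and columns are numbered from 0; in the same way
  the lists of block sizes and the summands are numbered from 0.  Multi-indices, in contrast, start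
  at 1 in each component, because their values enter the sampling points \<open>\<^bold>i / \<^bold>n\<close>.
\<close>

section \<open>Matrices\<close>

text \<open>There is no type class sum on matrices, since the zero matrix depends on the size.\<close>

definition mat_sum :: "nat \<Rightarrow> nat \<Rightarrow> ('i \<Rightarrow> complex mat) \<Rightarrow> 'i set \<Rightarrow> complex mat" where
  "mat_sum nr nc X S = Matrix.mat nr nc (\<lambda>(p, q). \<Sum>i\<in>S. X i $$ (p, q))"

definition kronecker :: "complex mat \<Rightarrow> complex mat \<Rightarrow> complex mat" (infixl "\<otimes>\<^sub>K" 70) where
  "X \<otimes>\<^sub>K Y = Matrix.mat (dim_row X * dim_row Y) (dim_col X * dim_col Y)
     (\<lambda>(p, q). X $$ (p div dim_row Y, q div dim_col Y) * Y $$ (p mod dim_row Y, q mod dim_col Y))"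

definition basis_column :: "nat \<Rightarrow> nat \<Rightarrow> complex mat" where
  "basis_column k i = mat_of_cols k [unit_vec k i]"

definition perm_mat :: "nat \<Rightarrow> nat \<Rightarrow> complex mat" where
  "perm_mat k1 k2 = mat_sum (k1 * k2) (k1 * k2)
     (\<lambda>i. basis_column k2 i \<otimes>\<^sub>K 1\<^sub>m k1 \<otimes>\<^sub>K transpose_mat (basis_column k2 i)) {..<k2}"

text \<open>
  \<open>block_array \<rho> \<sigma> rr ss X\<close> is the block matrix with blocks \<open>X i j\<close>, \<open>i < \<rho>\<close>, \<open>j < \<sigma>\<close>, where
  \<open>X i j\<close> has size \<open>rr i \<times> ss j\<close>.  The row (or column) number \<open>p\<close> falls into the block
  \<open>block_no rr p\<close>, which starts at \<open>block_start rr (block_no rr p)\<close>.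
\<close>

definition block_start :: "(nat \<Rightarrow> nat) \<Rightarrow> nat \<Rightarrow> nat" where
  "block_start rr i = (\<Sum>l<i. rr l)"

definition block_no :: "(nat \<Rightarrow> nat) \<Rightarrow> nat \<Rightarrow> nat" where
  "block_no rr p = (LEAST i. p < block_start rr (Suc i))"

definition block_array ::
    "nat \<Rightarrow> nat \<Rightarrow> (nat \<Rightarrow> nat) \<Rightarrow> (nat \<Rightarrow> nat) \<Rightarrow> (nat \<Rightarrow> nat \<Rightarrow> complex mat) \<Rightarrow> complex mat" where
  "block_array \<rho> \<sigma> rr ss X = Matrix.mat (\<Sum>i<\<rho>. rr i) (\<Sum>j<\<sigma>. ss j)
     (\<lambda>(p, q). X (block_no rr p) (block_no ss q)
        $$ (p - block_start rr (block_no rr p), q - block_start ss (block_no ss q)))"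

definition mat_rank :: "complex mat \<Rightarrow> nat" where
  "mat_rank X = vec_space.rank (dim_row X) X"

definition vec_norm2 :: "complex Matrix.vec \<Rightarrow> real" where
  "vec_norm2 v = sqrt (\<Sum>i<dim_vec v. (cmod (vec_index v i))\<^sup>2)"

definition spectral_norm :: "complex mat \<Rightarrow> real" where
  "spectral_norm X = (SUP v\<in>{v \<in> carrier_vec (dim_col X). vec_norm2 v \<le> 1}. vec_norm2 (X *\<^sub>v v))"

section \<open>Multi-indices and multilevel block matrices\<close>

definition N_of :: "('d::finite \<Rightarrow> nat) \<Rightarrow> nat" where
  "N_of n = (\<Prod>k\<in>UNIV. n k)"

definition index_box :: "('d \<Rightarrow> nat) \<Rightarrow> ('d \<Rightarrow> nat) set" where
  "index_box n = {i. \<forall>k. 1 \<le> i k \<and> i k \<le> n k}"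

definition lex_less :: "('d::linorder \<Rightarrow> nat) \<Rightarrow> ('d \<Rightarrow> nat) \<Rightarrow> bool" where
  "lex_less i j \<longleftrightarrow> (\<exists>k. i k < j k \<and> (\<forall>l<k. i l = j l))"

text \<open>Position (counted from 0) of a multi-index in the lexicographic enumeration of \<open>\<^bold>1,\<dots>,\<^bold>n\<close>.\<close>

definition lex_pos :: "('d::{finite,linorder} \<Rightarrow> nat) \<Rightarrow> ('d \<Rightarrow> nat) \<Rightarrow> nat" where
  "lex_pos n i = card {j \<in> index_box n. lex_less j i}"

definition multi_index :: "('d::{finite,linorder} \<Rightarrow> nat) \<Rightarrow> nat \<Rightarrow> ('d \<Rightarrow> nat)" where
  "multi_index n = the_inv_into (index_box n) (lex_pos n)"

text \<open>
  \<open>level_mat n r s x\<close> is the \<open>d\<close>-level \<open>(r,s)\<close>-block matrix \<open>[x\<^bsub>\<^bold>i\<^bold>j\<^esub>]\<close> with level orders \<open>n\<close>;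
  \<open>level_block n r s X \<^bold>i \<^bold>j\<close> recovers the block \<open>x\<^bsub>\<^bold>i\<^bold>j\<^esub>\<close> of an \<open>N(n)r \<times> N(n)s\<close> matrix \<open>X\<close>.
\<close>

definition level_mat ::
    "('d::{finite,linorder} \<Rightarrow> nat) \<Rightarrow> nat \<Rightarrow> nat \<Rightarrow> (('d \<Rightarrow> nat) \<Rightarrow> ('d \<Rightarrow> nat) \<Rightarrow> complex mat) \<Rightarrow> complex mat"
  where
  "level_mat n r s x = Matrix.mat (N_of n * r) (N_of n * s)
     (\<lambda>(p, q). x (multi_index n (p div r)) (multi_index n (q div s)) $$ (p mod r, q mod s))"

definition level_block ::
    "('d::{finite,linorder} \<Rightarrow> nat) \<Rightarrow> nat \<Rightarrow> nat \<Rightarrow> complex mat \<Rightarrow> ('d \<Rightarrow> nat) \<Rightarrow> ('d \<Rightarrow> nat) \<Rightarrow> complex mat"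
  where
  "level_block n r s X i j =
     Matrix.mat r s (\<lambda>(\<alpha>, \<beta>). X $$ (lex_pos n i * r + \<alpha>, lex_pos n j * s + \<beta>))"

text \<open>
  A matrix-sequence is indexed by an infinite set \<open>I\<close> of positive integers, and \<open>\<nu> n\<close> is the
  \<open>d\<close>-index \<open>\<^bold>n(n)\<close>.
\<close>

definition level_orders :: "nat set \<Rightarrow> (nat \<Rightarrow> 'd::finite \<Rightarrow> nat) \<Rightarrow> bool" where
  "level_orders I \<nu> \<longleftrightarrow> infinite I \<and> I \<subseteq> {1..} \<and> (\<forall>n\<in>I. \<forall>k. 1 \<le> \<nu> n k) \<and>
     filterlim (\<lambda>n. Min (range (\<nu> n))) at_top (inf sequentially (principal I))"

definition block_matrix_sequence ::
    "nat set \<Rightarrow> (nat \<Rightarrow> 'd::finite \<Rightarrow> nat) \<Rightarrow> nat \<Rightarrow> nat \<Rightarrow> (nat \<Rightarrow> complex mat) \<Rightarrow> bool" where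
  "block_matrix_sequence I \<nu> r s A \<longleftrightarrow> level_orders I \<nu> \<and>
     (\<forall>n\<in>I. A n \<in> carrier_mat (N_of (\<nu> n) * r) (N_of (\<nu> n) * s))"

section \<open>Symbols\<close>

definition symbol_domain :: "((real ^ 'd) \<times> (real ^ 'd)) set" where
  "symbol_domain = cbox (\<chi> k. 0) (\<chi> k. 1) \<times> cbox (\<chi> k. - pi) (\<chi> k. pi)"

definition measurable_symbol ::
    "nat \<Rightarrow> nat \<Rightarrow> ((real ^ 'd::finite) \<times> (real ^ 'd) \<Rightarrow> complex mat) \<Rightarrow> bool" where
  "measurable_symbol r s \<kappa> \<longleftrightarrow> (\<forall>z\<in>symbol_domain. \<kappa> z \<in> carrier_mat r s) \<and>
     (\<forall>\<alpha><r. \<forall>\<beta><s. (\<lambda>z. \<kappa> z $$ (\<alpha>, \<beta>)) \<in> borel_measurable (lebesgue_on symbol_domain))"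

text \<open>
  \<open>C\<^sup>k\<close> functions on a set \<open>S\<close>, by iterated directional derivatives relative to \<open>S\<close>; on the cube
  \<open>[0,1]\<^sup>d\<close> these derivatives are unique, and on its boundary they are one-sided.
\<close>

primrec C_k_on :: "nat \<Rightarrow> (real ^ 'd) set \<Rightarrow> (real ^ 'd::finite \<Rightarrow> complex) \<Rightarrow> bool" where
  "C_k_on 0 S a \<longleftrightarrow> continuous_on S a"
| "C_k_on (Suc k) S a \<longleftrightarrow>
     (\<exists>D. (\<forall>x\<in>S. (a has_derivative D x) (at x within S)) \<and> (\<forall>v. C_k_on k S (\<lambda>x. D x v)))"

definition smooth_on_cube :: "(real ^ 'd::finite \<Rightarrow> complex) \<Rightarrow> bool" where
  "smooth_on_cube a \<longleftrightarrow> (\<forall>k. C_k_on k (cbox (\<chi> k. 0) (\<chi> k. 1)) a)"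

definition freq_dot :: "('d::finite \<Rightarrow> int) \<Rightarrow> real ^ 'd \<Rightarrow> real" where
  "freq_dot j \<theta> = (\<Sum>k\<in>UNIV. of_int (j k) * vec_nth \<theta> k)"

definition unit_mat :: "nat \<Rightarrow> nat \<Rightarrow> nat \<Rightarrow> complex mat" where
  "unit_mat s \<alpha> \<beta> = Matrix.mat s s (\<lambda>(p, q). if p = \<alpha> \<and> q = \<beta> then 1 else 0)"

definition trig_monomials :: "nat \<Rightarrow> (real ^ 'd::finite \<Rightarrow> complex mat) set" where
  "trig_monomials s =
     {f. \<exists>j \<alpha> \<beta>. \<alpha> < s \<and> \<beta> < s \<and> f = (\<lambda>\<theta>. exp (\<i> * of_real (freq_dot j \<theta>)) \<cdot>\<^sub>m unit_mat s \<alpha> \<beta>)}"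

section \<open>Toeplitz and sampling matrices\<close>

definition fourier_coeff ::
    "nat \<Rightarrow> nat \<Rightarrow> (real ^ 'd::finite \<Rightarrow> complex mat) \<Rightarrow> ('d \<Rightarrow> int) \<Rightarrow> complex mat" where
  "fourier_coeff r s f k = Matrix.mat r s (\<lambda>(\<alpha>, \<beta>).
     (LINT \<theta>:cbox (\<chi> l. - pi) (\<chi> l. pi)|lebesgue.
        f \<theta> $$ (\<alpha>, \<beta>) * exp (- \<i> * of_real (freq_dot k \<theta>))) / (2 * of_real pi) ^ CARD('d))"

definition toeplitz_mat ::
    "('d::{finite,linorder} \<Rightarrow> nat) \<Rightarrow> nat \<Rightarrow> nat \<Rightarrow> (real ^ 'd::{finite,linorder} \<Rightarrow> complex mat) \<Rightarrow> complex mat" where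
  "toeplitz_mat n r s f = level_mat n r s (\<lambda>i j. fourier_coeff r s f (\<lambda>k. int (i k) - int (j k)))"

definition sampling_mat ::
    "('d::{finite,linorder} \<Rightarrow> nat) \<Rightarrow> (real ^ 'd::{finite,linorder} \<Rightarrow> complex mat) \<Rightarrow> complex mat" where
  "sampling_mat n a = diag_block_mat
     (map (\<lambda>p. a (\<chi> k. real (multi_index n p k) / real (n k))) [0..<N_of n])"

section \<open>Approximating classes of sequences and GLT sequences\<close>

text \<open>
  In \<open>acs I d e B A\<close> the matrices \<open>B m n\<close> and \<open>A n\<close>, \<open>n \<in> I\<close>, have size \<open>d n \<times> e n\<close>.
\<close>

definition acs ::
    "nat set \<Rightarrow> (nat \<Rightarrow> nat) \<Rightarrow> (nat \<Rightarrow> nat) \<Rightarrow> (nat \<Rightarrow> nat \<Rightarrow> complex mat) \<Rightarrow> (nat \<Rightarrow> complex mat) \<Rightarrow> bool"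
  where
  "acs I d e B A \<longleftrightarrow> (\<exists>(n0 :: nat \<Rightarrow> nat) (c :: nat \<Rightarrow> real) (\<omega> :: nat \<Rightarrow> real).
     c \<longlonglongrightarrow> 0 \<and> \<omega> \<longlonglongrightarrow> 0 \<and>
     (\<forall>m. \<forall>n\<in>I. n \<ge> n0 m \<longrightarrow>
        (\<exists>R\<in>carrier_mat (d n) (e n). \<exists>Q\<in>carrier_mat (d n) (e n).
           A n = B m n + R + Q \<and>
           real (mat_rank R) \<le> c m * real (min (d n) (e n)) \<and>
           spectral_norm Q \<le> \<omega> m)))"

definition square_GLT ::
    "nat set \<Rightarrow> (nat \<Rightarrow> 'd::{finite,linorder} \<Rightarrow> nat) \<Rightarrow> nat \<Rightarrow> (nat \<Rightarrow> complex mat)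
      \<Rightarrow> ((real ^ 'd::{finite,linorder}) \<times> (real ^ 'd::{finite,linorder}) \<Rightarrow> complex mat) \<Rightarrow> bool" where
  "square_GLT I \<nu> s A \<kappa> \<longleftrightarrow>
     (\<exists>(M :: nat \<Rightarrow> nat) (a :: nat \<Rightarrow> nat \<Rightarrow> real ^ 'd::{finite,linorder} \<Rightarrow> complex)
        (f :: nat \<Rightarrow> nat \<Rightarrow> real ^ 'd::{finite,linorder} \<Rightarrow> complex mat).
        (\<forall>m. \<forall>i<M m. smooth_on_cube (a m i) \<and> f m i \<in> trig_monomials s) \<and>
        (AE z in lebesgue_on symbol_domain. \<forall>\<alpha><s. \<forall>\<beta><s.
           (\<lambda>m. mat_sum s s (\<lambda>i. a m i (fst z) \<cdot>\<^sub>m f m i (snd z)) {..<M m} $$ (\<alpha>, \<beta>))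
             \<longlonglongrightarrow> \<kappa> z $$ (\<alpha>, \<beta>)) \<and>
        acs I (\<lambda>n. N_of (\<nu> n) * s) (\<lambda>n. N_of (\<nu> n) * s)
          (\<lambda>m n. mat_sum (N_of (\<nu> n) * s) (N_of (\<nu> n) * s)
             (\<lambda>i. sampling_mat (\<nu> n) (\<lambda>x. a m i x \<cdot>\<^sub>m 1\<^sub>m s) * toeplitz_mat (\<nu> n) s s (f m i)) {..<M m})
          A)"

definition extend_mat :: "nat \<Rightarrow> nat \<Rightarrow> nat \<Rightarrow> complex mat \<Rightarrow> complex mat" where
  "extend_mat r s t x = four_block_mat x (0\<^sub>m r (t - s)) (0\<^sub>m (t - r) s) (0\<^sub>m (t - r) (t - s))"

definition extend_level_mat ::
    "('d::{finite,linorder} \<Rightarrow> nat) \<Rightarrow> nat \<Rightarrow> nat \<Rightarrow> nat \<Rightarrow> complex mat \<Rightarrow> complex mat" where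
  "extend_level_mat n r s t X = level_mat n t t (\<lambda>i j. extend_mat r s t (level_block n r s X i j))"

text \<open>
  \<open>GLT I \<nu> r s A \<kappa>\<close> is the relation \<open>{A\<^sub>\<^bold>n}\<^sub>n \<sim>\<^bsub>GLT\<^esub> \<kappa>\<close> for a \<open>d\<close>-level \<open>(r,s)\<close>-block matrix-sequence
  \<open>A\<close> and a measurable symbol \<open>\<kappa>\<close>.  These two typing conditions are not part of the predicate; they
  are \<^const>\<open>block_matrix_sequence\<close> and \<^const>\<open>measurable_symbol\<close>.
\<close>

definition GLT ::
    "nat set \<Rightarrow> (nat \<Rightarrow> 'd::{finite,linorder} \<Rightarrow> nat) \<Rightarrow> nat \<Rightarrow> nat \<Rightarrow> (nat \<Rightarrow> complex mat)
      \<Rightarrow> ((real ^ 'd::{finite,linorder}) \<times> (real ^ 'd::{finite,linorder}) \<Rightarrow> complex mat) \<Rightarrow> bool" where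
  "GLT I \<nu> r s A \<kappa> \<longleftrightarrow> (\<forall>t \<ge> max r s.
     square_GLT I \<nu> t (\<lambda>n. extend_level_mat (\<nu> n) r s t (A n)) (\<lambda>z. extend_mat r s t (\<kappa> z)))"

section \<open>The lexicographic enumeration is well defined\<close>

lemma finite_index_box: "finite (index_box (n :: 'd::finite \<Rightarrow> nat))"
  and card_index_box: "card (index_box n) = N_of n"
proof -
  have eq: "index_box n = PiE UNIV (\<lambda>k. {1..n k})"
    by (auto simp: index_box_def PiE_def Pi_def)
  show "finite (index_box n)" unfolding eq by (intro finite_PiE) auto
  show "card (index_box n) = N_of n" unfolding eq by (simp add: card_PiE N_of_def)
qed

lemma lex_less_irrefl: "\<not> lex_less i i"
  by (auto simp: lex_less_def)

lemma lex_less_trans: "lex_less i j \<Longrightarrow> lex_less j l \<Longrightarrow> lex_less i l"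
proof -
  assume "lex_less i j" "lex_less j l"
  then obtain a b where a: "i a < j a" "\<forall>k<a. i k = j k" and b: "j b < l b" "\<forall>k<b. j k = l k"
    unfolding lex_less_def by blast
  have "i (min a b) < l (min a b)" "\<forall>k<min a b. i k = l k"
    using a b by (cases a b rule: linorder_cases; auto simp: min_def)+
  thus "lex_less i l" unfolding lex_less_def by blast
qed

lemma lex_less_total:
  fixes i j :: "'d::{finite,linorder} \<Rightarrow> nat"
  assumes "i \<noteq> j" shows "lex_less i j \<or> lex_less j i"
proof -
  define S where "S = {k. i k \<noteq> j k}"
  have fin: "finite S" and ne: "S \<noteq> {}" using assms by (auto simp: S_def)
  define k where "k = Min S"
  have k: "i k \<noteq> j k" using Min_in[OF fin ne] by (simp add: S_def k_def)
  have l: "i l = j l" if "l < k" for l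
  proof (rule ccontr)
    assume "i l \<noteq> j l"
    hence "k \<le> l" unfolding k_def by (intro Min_le[OF fin]) (simp add: S_def)
    with that show False by simp
  qed
  show ?thesis
  proof (cases "i k < j k")
    case True
    with l show ?thesis unfolding lex_less_def by blast
  next
    case False
    with k have "j k < i k" by simp
    moreover have "\<forall>l<k. j l = i l" using l by simp
    ultimately show ?thesis unfolding lex_less_def by blast
  qed
qed

lemma lex_pos_strict_mono:
  assumes "i \<in> index_box n" "lex_less i j"
  shows "lex_pos n i < lex_pos n j"
proof -
  have "{l \<in> index_box n. lex_less l i} \<subseteq> {l \<in> index_box n. lex_less l j}"
    using assms(2) by (auto intro: lex_less_trans)
  moreover have "i \<in> {l \<in> index_box n. lex_less l j}" "i \<notin> {l \<in> index_box n. lex_less l i}"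
    using assms by (auto simp: lex_less_irrefl)
  ultimately show ?thesis unfolding lex_pos_def
    using finite_index_box[of n] by (intro psubset_card_mono) auto
qed

lemma lex_pos_bij: "bij_betw (lex_pos n) (index_box n) {..<N_of n}"
proof -
  have inj: "inj_on (lex_pos n) (index_box n)"
  proof (rule inj_onI, rule ccontr)
    fix i j assume "i \<in> index_box n" "j \<in> index_box n" "lex_pos n i = lex_pos n j" "i \<noteq> j"
    thus False
      using lex_less_total[of i j] lex_pos_strict_mono[of i n j] lex_pos_strict_mono[of j n i] by auto
  qed
  have "lex_pos n i < card (index_box n)" if "i \<in> index_box n" for i
    unfolding lex_pos_def using that lex_less_irrefl finite_index_box[of n]
    by (intro psubset_card_mono) auto
  hence "lex_pos n ` index_box n \<subseteq> {..<N_of n}" by (auto simp: card_index_box)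
  moreover have "card (lex_pos n ` index_box n) = N_of n"
    using card_image[OF inj] by (simp add: card_index_box)
  ultimately have "lex_pos n ` index_box n = {..<N_of n}"
    by (intro card_subset_eq) auto
  with inj show ?thesis by (simp add: bij_betw_def)
qed

end

theory Submission
  imports Defs
begin

text \<open>
  If \<open>P\<close> and \<open>Q\<close> are partial permutation matrices and \<open>A\<close> is a \<open>t\<close>-block GLT sequence with symbol
  \<open>\<kappa>\<close>, then \<open>(I \<otimes> P) A (I \<otimes> Q)\<close> is a GLT sequence with symbol \<open>P \<kappa> Q\<close>: multiplication by such matrices
  maps each term \<open>D\<^sub>n(a I) T\<^sub>n(f)\<close> of an approximation with a trigonometric monomial \<open>f\<close> to a term of the
  same kind or to zero, and it increases neither rank nor spectral norm.  The blocks of a block matrix are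
  obtained from the matrix by such multiplications, and the matrix is the sum of its blocks multiplied
  by the transposes.  As sums of GLT sequences are GLT sequences, this gives both directions.
\<close>

section \<open>Rank, spectral norm and partial permutations\<close>

text \<open>The multipliers are partial permutation matrices because \<open>square_GLT\<close>
  admits only single matrix units as coefficients of monomials: a matrix unit between two partial
  permutation matrices is again a matrix unit or zero, whereas a general constant matrix would turn
  one term into a sum. The multipliers act on the approximants directly and are never treated as GLT
  sequences themselves. They may be rectangular, and this deals with the extension operator:
  \<open>GLT\<close> quantifies over all padded sizes, and a single sandwich both moves a block and
  changes the padded size from \<open>t\<close> to \<open>u\<close>. Padding coordinates have no
  partner and become zero rows and columns. Since rank bounds are relative to the order of the
  matrix, a change of size costs the fixed factor t / u. The formula with the permutation matrices
  is independent of GLT sequences. Both outer factors have exactly one 1 in each row, and its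
  position is found by division with remainder.\<close>

lemma rank_mult_right_le:
  assumes X: "X \<in> carrier_mat n k" and Q: "Q \<in> carrier_mat k l"
  shows "mat_rank (X * Q) \<le> mat_rank X"
proof -
  interpret vec_space "TYPE(complex)" n .
  have XQ: "X * Q \<in> carrier_mat n l" using X Q by simp
  have colsX: "set (cols X) \<subseteq> carrier_vec n" and colsXQ: "set (cols (X * Q)) \<subseteq> carrier_vec n"
    using cols_dim[of X] cols_dim[of "X * Q"] X XQ by auto
  \<comment> \<open>Column \<open>j\<close> of \<open>X * Q\<close> is \<open>X\<close> applied to
    column \<open>j\<close> of \<open>Q\<close>, hence an element of the column space of
    \<open>X\<close>; rank is monotone in the column space.\<close>
  have "set (cols (X * Q)) \<subseteq> span (set (cols X))"
  proof
    fix x assume "x \<in> set (cols (X * Q))"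
    then obtain j where j: "j < l" "x = col (X * Q) j"
      using XQ by (metis cols_length cols_nth carrier_matD(2) in_set_conv_nth)
    hence "x = X *\<^sub>v col Q j" using col_mult2[OF X Q] by simp
    moreover have "x \<in> carrier_vec n" using j XQ by auto
    ultimately have "x \<in> col_space X"
      unfolding col_space_eq[OF X] using X Q j by (auto intro!: bexI[of _ "col Q j"])
    thus "x \<in> span (set (cols X))" unfolding col_space_def .
  qed
  hence sub: "span (set (cols (X * Q))) \<subseteq> span (set (cols X))"
    using span_is_submodule[OF colsX] by (simp add: span_is_subset)
  have subs: "subspace class_ring (span (set (cols (X * Q)))) (vs (span (set (cols X))))"
    using nested_subspaces[OF span_is_subspace[OF colsX] span_is_subspace[OF colsXQ] sub] .
  have "rank (X * Q) \<le> rank X" unfolding rank_def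
    using vectorspace.subspace_dim[OF subspace_is_vs[OF span_is_subspace[OF colsX]] subs]
      fin_dim_span_cols[OF X] fin_dim_span_cols[OF XQ] by simp
  thus ?thesis using X by (simp add: mat_rank_def)
qed

text \<open>Preimages of linearly independent columns of \<open>P * X\<close> are linearly independent.\<close>

lemma rank_mult_left_le:
  assumes P: "P \<in> carrier_mat m n" and X: "X \<in> carrier_mat n k"
  shows "mat_rank (P * X) \<le> mat_rank X"
proof -
  interpret n: vec_space "TYPE(complex)" n .
  interpret m: vec_space "TYPE(complex)" m .
  have PX: "P * X \<in> carrier_mat m k" using P X by simp
  let ?ind = "\<lambda>T. T \<subseteq> set (cols (P * X)) \<and> m.lin_indpt T"
  have "\<exists>S. finite S \<and> maximal S ?ind \<and> {} \<subseteq> S"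
  proof (rule maximal_exists_superset)
    show "finite (set (cols (P * X)))" by simp
    show "T \<subseteq> set (cols (P * X))" if "?ind T" for T using that by (rule conjunct1)
    have "m.lin_indpt {}" by (rule m.finite_lin_indpt2) auto
    thus "?ind {}" by simp
  qed
  then obtain S where S: "finite S" "maximal S ?ind" by auto
  have rank: "m.rank (P * X) = card S" using m.rank_card_indpt[OF PX S(2)] .
  have Sc: "S \<subseteq> set (cols (P * X))" and Si: "m.lin_indpt S"
    using S(2) unfolding maximal_def by - (elim conjE, assumption)+
  obtain ss where ss: "set ss = S" "distinct ss" using finite_distinct_list[OF S(1)] by blast
  have "\<exists>t\<in>set (cols X). P *\<^sub>v t = x" if x: "x \<in> S" for x
  proof -
    obtain j where "j < k" "x = col (P * X) j"
    proof (atomize_elim)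
      have "x \<in> set (cols (P * X))" using x Sc by blast
      hence "\<exists>j<dim_col (P * X). x = col (P * X) j" unfolding cols_def by auto
      thus "\<exists>j. j < k \<and> x = col (P * X) j" using carrier_matD(2)[OF PX] by metis
    qed
    note j = this
    hence "x = P *\<^sub>v col X j" using col_mult2[OF P X] by simp
    moreover have "col X j \<in> set (cols X)" using j X by (auto simp: cols_def)
    ultimately show ?thesis by blast
  qed
  \<comment> \<open>\<open>g\<close> picks one column of \<open>X\<close> above each vector of
    \<open>S\<close>. It is injective because \<open>P\<close> undoes it.\<close>
  then obtain g where g: "\<And>x. x \<in> S \<Longrightarrow> g x \<in> set (cols X)" "\<And>x. x \<in> S \<Longrightarrow> P *\<^sub>v g x = x" by metis
  define ts where "ts = map g ss"
  have inj: "inj_on g S" by (rule inj_onI) (metis g(2))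
  have dts: "distinct ts" unfolding ts_def using ss inj by (simp add: distinct_map)
  have tsX: "set ts \<subseteq> set (cols X)" using g(1) ss by (auto simp: ts_def)
  have tsc: "set ts \<subseteq> carrier_vec n" using tsX cols_dim[of X] X by auto
  have ssc: "set ss \<subseteq> carrier_vec m" using ss Sc cols_dim[of "P * X"] P by auto
  define T where "T = mat_of_cols n ts"
  have T: "T \<in> carrier_mat n (length ts)" by (simp add: T_def)
  have cT: "cols T = ts" unfolding T_def using tsc by (rule cols_mat_of_cols)
  have PT: "P * T = mat_of_cols m ss"
  proof (rule mat_col_eqI)
    fix i assume "i < dim_col (mat_of_cols m ss)"
    hence i: "i < length ss" by simp
    have "col T i = ts ! i" using i tsc unfolding T_def ts_def by (subst col_mat_of_cols) auto
    hence "col (P * T) i = P *\<^sub>v (g (ss ! i))" using col_mult2[OF P T] i by (simp add: ts_def)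
    also have "\<dots> = ss ! i" using g(2) i ss by auto
    also have "\<dots> = col (mat_of_cols m ss) i" using i ssc by (subst col_mat_of_cols) auto
    finally show "col (P * T) i = col (mat_of_cols m ss) i" .
  qed (use P T in \<open>auto simp: ts_def\<close>)
  have cPT: "cols (P * T) = ss" unfolding PT using ssc by (rule cols_mat_of_cols)
  \<comment> \<open>A nonzero vector annihilated by \<open>T\<close> is also annihilated by
    \<open>P * T\<close>, whose columns are the independent vectors of \<open>S\<close>.\<close>
  have "n.lin_indpt (set (cols T))"
  proof
    assume "n.lin_dep (set (cols T))"
    then obtain v where v: "v \<in> carrier_vec (length ts)" "v \<noteq> 0\<^sub>v (length ts)" "T *\<^sub>v v = 0\<^sub>v n"
      using n.lin_depE[OF T] dts cT by metis
    have "(P * T) *\<^sub>v v = P *\<^sub>v (T *\<^sub>v v)" using P T v by simp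
    also have "\<dots> = 0\<^sub>v m" using P v by auto
    finally have "m.lin_dep (set (cols (P * T)))"
      using m.lin_depI[of "P * T" "length ts" v] P T v ss cPT by auto
    thus False using Si ss cPT by simp
  qed
  hence "card (set ts) \<le> n.rank X" using n.rank_ge_card_indpt[OF X tsX] cT by simp
  moreover have "card (set ts) = card S" using inj ss by (simp add: ts_def card_image)
  ultimately show ?thesis using rank P X by (simp add: mat_rank_def)
qed

lemma rank_add_le:
  assumes "X \<in> carrier_mat n k" "Y \<in> carrier_mat n k"
  shows "mat_rank (X + Y) \<le> mat_rank X + mat_rank Y"
  using vec_space.rank_subadditive[OF assms] assms by (simp add: mat_rank_def)

lemma rank_zero: "mat_rank (0\<^sub>m n k) = 0"
  by (simp add: mat_rank_def vec_space.rank_0I)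

section \<open>Euclidean norm and spectral norm\<close>

lemma vec_norm2_L2: "vec_norm2 v = L2_set (\<lambda>i. cmod (vec_index v i)) {..<dim_vec v}"
  by (simp add: vec_norm2_def L2_set_def)

lemma vec_norm2_zero: "vec_norm2 (0\<^sub>v n) = 0"
  by (simp add: vec_norm2_def)

lemma vec_norm2_add_le:
  assumes "v \<in> carrier_vec n" "w \<in> carrier_vec n"
  shows "vec_norm2 (v + w) \<le> vec_norm2 v + vec_norm2 w"
proof -
  have "vec_norm2 (v + w) \<le> L2_set (\<lambda>i. cmod (vec_index v i) + cmod (vec_index w i)) {..<n}"
    unfolding vec_norm2_L2 using assms by (auto intro!: L2_set_mono norm_triangle_ineq)
  also have "\<dots> \<le> vec_norm2 v + vec_norm2 w"
    unfolding vec_norm2_L2 using assms L2_set_triangle_ineq by fastforce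
  finally show ?thesis .
qed

text \<open>The bound is crude. Its purpose is that the set in the definition of
  \<open>spectral_norm\<close> is bounded above, so that its real supremum really is an upper
  bound.\<close>

lemma vec_norm2_mult_bounded:
  assumes v: "v \<in> carrier_vec (dim_col X)" and v1: "vec_norm2 v \<le> 1"
  shows "vec_norm2 (X *\<^sub>v v) \<le> (\<Sum>i<dim_row X. \<Sum>j<dim_col X. cmod (X $$ (i, j)))"
proof -
  have le1: "cmod (vec_index v j) \<le> 1" if "j < dim_col X" for j
    using member_le_L2_set[of "{..<dim_vec v}" j "\<lambda>i. cmod (vec_index v i)"] that v v1 
    by (auto simp: vec_norm2_L2)
  have "vec_norm2 (X *\<^sub>v v) \<le> (\<Sum>i<dim_row X. cmod (vec_index (X *\<^sub>v v) i))"
    unfolding vec_norm2_L2 by (rule order_trans[OF L2_set_le_sum]) auto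
  also have "\<dots> \<le> (\<Sum>i<dim_row X. \<Sum>j<dim_col X. cmod (X $$ (i, j)))"
  proof (rule sum_mono)
    fix i assume i: "i \<in> {..<dim_row X}"
    have "vec_index (X *\<^sub>v v) i = (\<Sum>j<dim_col X. X $$ (i, j) * vec_index v j)"
      using i v by (simp add: scalar_prod_def lessThan_atLeast0)
    also have "cmod \<dots> \<le> (\<Sum>j<dim_col X. cmod (X $$ (i, j)) * cmod (vec_index v j))"
      by (rule order_trans[OF norm_sum]) (simp add: norm_mult)
    also have "\<dots> \<le> (\<Sum>j<dim_col X. cmod (X $$ (i, j)))"
      using le1 by (intro sum_mono) (simp add: mult_left_le)
    finally show "cmod (vec_index (X *\<^sub>v v) i) \<le> (\<Sum>j<dim_col X. cmod (X $$ (i, j)))" .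
  qed
  finally show ?thesis .
qed

lemma vec_norm2_mult_le_spectral_norm:
  assumes "v \<in> carrier_vec (dim_col X)" "vec_norm2 v \<le> 1"
  shows "vec_norm2 (X *\<^sub>v v) \<le> spectral_norm X"
  unfolding spectral_norm_def using assms vec_norm2_mult_bounded
  by (intro cSUP_upper) (auto intro!: bdd_aboveI2)

text \<open>To bound the supremum from above, the unit ball has to be nonempty; the zero vector
  supplies an element.\<close>

lemma spectral_norm_leI:
  assumes "\<And>v. v \<in> carrier_vec (dim_col X) \<Longrightarrow> vec_norm2 v \<le> 1 \<Longrightarrow> vec_norm2 (X *\<^sub>v v) \<le> c"
  shows "spectral_norm X \<le> c"
proof -
  have "0\<^sub>v (dim_col X) \<in> {v \<in> carrier_vec (dim_col X). vec_norm2 v \<le> 1}"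
    by (simp add: vec_norm2_zero)
  thus ?thesis unfolding spectral_norm_def using assms by (intro cSUP_least) blast+
qed

lemma spectral_norm_add_le:
  assumes X: "X \<in> carrier_mat n k" and Y: "Y \<in> carrier_mat n k"
  shows "spectral_norm (X + Y) \<le> spectral_norm X + spectral_norm Y"
proof (rule spectral_norm_leI)
  fix v assume "v \<in> carrier_vec (dim_col (X + Y))" and v1: "vec_norm2 v \<le> 1"
  hence v: "v \<in> carrier_vec k" using Y by simp
  have "(X + Y) *\<^sub>v v = X *\<^sub>v v + Y *\<^sub>v v" using X Y v by (rule add_mult_distrib_mat_vec)
  also have "vec_norm2 \<dots> \<le> vec_norm2 (X *\<^sub>v v) + vec_norm2 (Y *\<^sub>v v)"
    using X Y by (intro vec_norm2_add_le[of _ n]) (auto simp: carrier_vecI)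
  also have "\<dots> \<le> spectral_norm X + spectral_norm Y"
    using X Y v v1 by (intro add_mono vec_norm2_mult_le_spectral_norm) auto
  finally show "vec_norm2 ((X + Y) *\<^sub>v v) \<le> spectral_norm X + spectral_norm Y" .
qed

lemma spectral_norm_zero_le: "spectral_norm (0\<^sub>m n k) \<le> 0"
proof (rule spectral_norm_leI)
  fix v :: "complex Matrix.vec" assume "v \<in> carrier_vec (dim_col (0\<^sub>m n k :: complex mat))"
  hence "0\<^sub>m n k *\<^sub>v v = 0\<^sub>v n" by (intro eq_vecI) auto
  thus "vec_norm2 (0\<^sub>m n k *\<^sub>v v) \<le> 0" by (simp add: vec_norm2_zero)
qed

text \<open>Equivalent to spectral norm at most 1. The form with vectors of arbitrary norm composes
  without rescaling to the unit ball.\<close>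

definition contraction :: "complex mat \<Rightarrow> bool" where
  "contraction P \<longleftrightarrow> (\<forall>v\<in>carrier_vec (dim_col P). vec_norm2 (P *\<^sub>v v) \<le> vec_norm2 v)"

lemma spectral_norm_contraction_le:
  assumes P: "P \<in> carrier_mat m n" "contraction P" and X: "X \<in> carrier_mat n k"
    and Q: "Q \<in> carrier_mat k l" "contraction Q"
  shows "spectral_norm (P * X * Q) \<le> spectral_norm X"
proof (rule spectral_norm_leI)
  fix v assume "v \<in> carrier_vec (dim_col (P * X * Q))" and v1: "vec_norm2 v \<le> 1"
  hence v: "v \<in> carrier_vec l" using Q by simp
  have Qv: "Q *\<^sub>v v \<in> carrier_vec k" using Q v by simp
  have "P * X * Q *\<^sub>v v = P *\<^sub>v (X *\<^sub>v (Q *\<^sub>v v))"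
    using assoc_mult_mat_vec[of "P * X" m k Q l v] assoc_mult_mat_vec[of P m n X k "Q *\<^sub>v v"] P X Q v Qv
    by simp
  also have "vec_norm2 \<dots> \<le> vec_norm2 (X *\<^sub>v (Q *\<^sub>v v))"
    using P X Qv by (auto simp: contraction_def)
  also have "\<dots> \<le> spectral_norm X"
  proof (rule vec_norm2_mult_le_spectral_norm)
    have "vec_norm2 (Q *\<^sub>v v) \<le> vec_norm2 v" using Q v by (auto simp: contraction_def)
    thus "vec_norm2 (Q *\<^sub>v v) \<le> 1" using v1 by simp
  qed (use X Qv in auto)
  finally show "vec_norm2 (P * X * Q *\<^sub>v v) \<le> spectral_norm X" .
qed

section \<open>Partial permutation matrices\<close>

definition rel_mat :: "nat \<Rightarrow> nat \<Rightarrow> (nat \<Rightarrow> nat \<Rightarrow> bool) \<Rightarrow> complex mat" where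
  "rel_mat nr nc S = Matrix.mat nr nc (\<lambda>(p, q). of_bool (S p q))"

text \<open>The condition makes \<open>rel_mat\<close> a partial permutation matrix, with at most
  one 1 in each row and column. Relations are used instead of maps because rows and columns may be
  empty, and because transposition is then passage to the converse relation.\<close>

definition partial_inj :: "(nat \<Rightarrow> nat \<Rightarrow> bool) \<Rightarrow> bool" where
  "partial_inj S \<longleftrightarrow> (\<forall>p q q'. S p q \<longrightarrow> S p q' \<longrightarrow> q = q') \<and> (\<forall>p p' q. S p q \<longrightarrow> S p' q \<longrightarrow> p = p')"

lemma partial_inj_conversep: "partial_inj S \<Longrightarrow> partial_inj (\<lambda>p q. S q p)"
  unfolding partial_inj_def by blast

lemma rel_mat_carrier [simp]: "rel_mat nr nc S \<in> carrier_mat nr nc"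
  and dim_row_rel_mat [simp]: "dim_row (rel_mat nr nc S) = nr"
  and dim_col_rel_mat [simp]: "dim_col (rel_mat nr nc S) = nc"
  and index_rel_mat: "p < nr \<Longrightarrow> q < nc \<Longrightarrow> rel_mat nr nc S $$ (p, q) = of_bool (S p q)"
  by (simp_all add: rel_mat_def)

lemma sum_of_bool_unique:
  assumes "finite A" "\<And>x y. S x \<Longrightarrow> S y \<Longrightarrow> x = y"
  shows "(\<Sum>x\<in>A. of_bool (S x) * f x) = (if \<exists>x\<in>A. S x then f (THE x. S x) else (0::'a::semiring_1))"
proof (cases "\<exists>x\<in>A. S x")
  case True
  then obtain a where a: "a \<in> A" "S a" by blast
  hence eq: "S x \<longleftrightarrow> x = a" for x using assms(2) by blast
  show ?thesis using a assms(1) by (auto simp: eq of_bool_def if_distrib[of "\<lambda>c. c * _"] sum.delta cong: if_cong)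
qed auto

text \<open>Every entry of the image is zero or an entry of \<open>v\<close>, and different rows
  select different entries. Hence the squared norm of the image is a partial sum of the squared norm
  of \<open>v\<close>.\<close>

lemma contraction_rel_mat:
  assumes "partial_inj S"
  shows "contraction (rel_mat nr nc S)"
  unfolding contraction_def
proof
  fix v :: "complex Matrix.vec" assume v: "v \<in> carrier_vec (dim_col (rel_mat nr nc S))"
  let ?w = "rel_mat nr nc S *\<^sub>v v"
  have w: "(cmod (vec_index ?w p))\<^sup>2 = (\<Sum>q<nc. of_bool (S p q) * (cmod (vec_index v q))\<^sup>2)"
    if "p < nr" for p
  proof -
    have "vec_index ?w p = (\<Sum>q<nc. of_bool (S p q) * vec_index v q)"
      using that v by (simp add: scalar_prod_def lessThan_atLeast0 index_rel_mat)
    thus ?thesis using assms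
      by (simp add: sum_of_bool_unique partial_inj_def del: sum_of_bool_mult_eq)
  qed
  have "(\<Sum>p<nr. (cmod (vec_index ?w p))\<^sup>2) = (\<Sum>q<nc. \<Sum>p<nr. of_bool (S p q) * (cmod (vec_index v q))\<^sup>2)"
    by (subst sum.swap) (simp add: w del: sum_of_bool_mult_eq index_mult_mat_vec)
  also have "\<dots> \<le> (\<Sum>q<nc. (cmod (vec_index v q))\<^sup>2)"
    using assms by (intro sum_mono) (auto simp: sum_of_bool_unique partial_inj_def simp del: sum_of_bool_mult_eq)
  finally show "vec_norm2 ?w \<le> vec_norm2 v"
    using v by (simp add: vec_norm2_def)
qed

lemma index_mult3:
  assumes P: "P \<in> carrier_mat m n" and X: "X \<in> carrier_mat n k" and Q: "Q \<in> carrier_mat k l"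
    and "p < m" "q < l"
  shows "(P * X * Q) $$ (p, q) = (\<Sum>i<n. \<Sum>j<k. P $$ (p, i) * X $$ (i, j) * Q $$ (j, q))"
proof -
  have "(P * X * Q) $$ (p, q) = (\<Sum>j<k. (\<Sum>i<n. P $$ (p, i) * X $$ (i, j)) * Q $$ (j, q))"
    using assms by (simp add: scalar_prod_def lessThan_atLeast0 del: assoc_mult_mat)
  also have "\<dots> = (\<Sum>i<n. \<Sum>j<k. P $$ (p, i) * X $$ (i, j) * Q $$ (j, q))"
    by (subst sum.swap) (simp add: sum_distrib_right)
  finally show ?thesis .
qed

text \<open>In the double sum for an entry, at most one term survives: the one at the partner of
  \<open>p\<close> under \<open>S\<close> and the partner of \<open>q\<close> under
  \<open>S'\<close>. The conclusions cover the three cases that both partners are in range, that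
  \<open>p\<close> has none, or that \<open>q\<close> has none; later products are evaluated by this
  case distinction.\<close>

lemma rel_mat_sandwich:
  assumes X: "X \<in> carrier_mat n k" and p: "p < m" and q: "q < l"
    and S: "partial_inj S" and S': "partial_inj S'"
  shows rel_mat_sandwich_entry: "S p i \<Longrightarrow> S' j q \<Longrightarrow> i < n \<Longrightarrow> j < k \<Longrightarrow>
      (rel_mat m n S * X * rel_mat k l S') $$ (p, q) = X $$ (i, j)"
    and rel_mat_sandwich_zero_row: "(\<And>i. i < n \<Longrightarrow> \<not> S p i) \<Longrightarrow>
      (rel_mat m n S * X * rel_mat k l S') $$ (p, q) = 0"
    and rel_mat_sandwich_zero_col: "(\<And>j. j < k \<Longrightarrow> \<not> S' j q) \<Longrightarrow>
      (rel_mat m n S * X * rel_mat k l S') $$ (p, q) = 0"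
proof -
  have eq: "(rel_mat m n S * X * rel_mat k l S') $$ (p, q) =
      (\<Sum>i<n. \<Sum>j<k. of_bool (S p i) * X $$ (i, j) * of_bool (S' j q))"
    using p q by (simp add: index_mult3[OF rel_mat_carrier X rel_mat_carrier] index_rel_mat
        del: sum_of_bool_mult_eq sum_mult_of_bool_eq index_mult_mat)
  show "(rel_mat m n S * X * rel_mat k l S') $$ (p, q) = X $$ (i, j)"
    if "S p i" "S' j q" "i < n" "j < k"
  proof -
    have 1: "S p i' \<longleftrightarrow> i' = i" and 2: "S' j' q \<longleftrightarrow> j' = j" for i' j'
      using that S S' unfolding partial_inj_def by blast+
    have "(\<Sum>i<n. \<Sum>j<k. of_bool (S p i) * X $$ (i, j) * of_bool (S' j q)) =
        (\<Sum>i'<n. if i' = i then (\<Sum>j'<k. if j' = j then X $$ (i', j') else 0) else 0)"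
      by (intro sum.cong refl) (auto simp: 1 2 intro!: sum.cong)
    thus ?thesis unfolding eq using that by simp
  qed
qed (auto simp: index_mult3[OF rel_mat_carrier X rel_mat_carrier] index_rel_mat p q
      simp del: index_mult_mat intro!: sum.neutral)

section \<open>Block arrays and level-wise multiplication\<close>

lemma multi_index_in_box: "p < N_of n \<Longrightarrow> multi_index n p \<in> index_box n"
  unfolding multi_index_def using lex_pos_bij[of n] the_inv_into_into[of "lex_pos n" "index_box n" p]
  by (auto simp: bij_betw_def)

lemma lex_pos_multi_index: "p < N_of n \<Longrightarrow> lex_pos n (multi_index n p) = p"
  unfolding multi_index_def 
  using f_the_inv_into_f_bij_betw[OF lex_pos_bij[of n], of p] by simp

lemma multi_index_lex_pos: "i \<in> index_box n \<Longrightarrow> multi_index n (lex_pos n i) = i"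
  unfolding multi_index_def using lex_pos_bij[of n]
  by (auto simp: bij_betw_def intro!: the_inv_into_f_f)

lemma lex_pos_less: "i \<in> index_box n \<Longrightarrow> lex_pos n i < N_of n"
  using lex_pos_bij[of n] by (auto simp: bij_betw_def)

lemma mod_less_of_less_mult: "p < N * r \<Longrightarrow> p mod r < (r::nat)"
  by (cases "r = 0") auto

lemma mult_add_less: "a < N \<Longrightarrow> b < r \<Longrightarrow> a * r + b < N * (r::nat)"
  using mult_le_mono1[of "Suc a" N r] by simp

lemma level_mat_carrier [simp]: "level_mat n r s x \<in> carrier_mat (N_of n * r) (N_of n * s)"
  and dim_row_level_mat [simp]: "dim_row (level_mat n r s x) = N_of n * r"
  and dim_col_level_mat [simp]: "dim_col (level_mat n r s x) = N_of n * s"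
  by (simp_all add: level_mat_def)

lemma index_level_mat:
  "p < N_of n * r \<Longrightarrow> q < N_of n * s \<Longrightarrow> level_mat n r s x $$ (p, q) =
     x (multi_index n (p div r)) (multi_index n (q div s)) $$ (p mod r, q mod s)"
  by (simp add: level_mat_def)

lemma level_mat_cong:
  assumes "\<And>i j \<alpha> \<beta>. i \<in> index_box n \<Longrightarrow> j \<in> index_box n \<Longrightarrow> \<alpha> < r \<Longrightarrow> \<beta> < s \<Longrightarrow>
    x i j $$ (\<alpha>, \<beta>) = y i j $$ (\<alpha>, \<beta>)"
  shows "level_mat n r s x = level_mat n r s y"
  by (rule eq_matI)
    (auto simp: index_level_mat less_mult_imp_div_less mod_less_of_less_mult
      intro!: assms multi_index_in_box)

lemma level_block_level_mat:
  assumes "i \<in> index_box n" "j \<in> index_box n" "x i j \<in> carrier_mat r s"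
  shows "level_block n r s (level_mat n r s x) i j = x i j"
proof (rule eq_matI)
  fix \<alpha> \<beta> assume "\<alpha> < dim_row (x i j)" "\<beta> < dim_col (x i j)"
  hence ab: "\<alpha> < r" "\<beta> < s" using assms by auto
  show "level_block n r s (level_mat n r s x) i j $$ (\<alpha>, \<beta>) = x i j $$ (\<alpha>, \<beta>)"
    using ab assms mult_add_less[OF lex_pos_less[OF assms(1)] ab(1)]
      mult_add_less[OF lex_pos_less[OF assms(2)] ab(2)]
    by (simp add: level_block_def index_level_mat multi_index_lex_pos)
qed (use assms in \<open>auto simp: level_block_def\<close>)

text \<open>A matrix sum takes its dimensions from the second summand, which is why the size is
  assumed for \<open>y\<close> alone. The same asymmetry recurs in \<open>mat_sum_insert\<close> and
  \<open>square_GLT_add\<close>.\<close>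

lemma level_mat_add:
  assumes "\<And>i j. y i j \<in> carrier_mat r s"
  shows "level_mat n r s (\<lambda>i j. x i j + y i j) = level_mat n r s x + level_mat n r s y"
proof (rule eq_matI)
  fix p q assume pq: "p < dim_row (level_mat n r s x + level_mat n r s y)"
    "q < dim_col (level_mat n r s x + level_mat n r s y)"
  hence pq': "p < N_of n * r" "q < N_of n * s" by auto
  show "level_mat n r s (\<lambda>i j. x i j + y i j) $$ (p, q) = (level_mat n r s x + level_mat n r s y) $$ (p, q)"
    using pq' assms by (simp add: index_level_mat mod_less_of_less_mult carrier_matD[OF assms])
qed auto

lemma level_mat_zero: "level_mat n r s (\<lambda>i j. 0\<^sub>m r s) = 0\<^sub>m (N_of n * r) (N_of n * s)"
  by (rule eq_matI) (auto simp: index_level_mat mod_less_of_less_mult)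

text \<open>\<open>rel_mat (N * u) (N * t) (lift_rel u t S)\<close> is the Kronecker product of the identity of order \<open>N\<close>
  with \<open>rel_mat u t S\<close>.\<close>

definition lift_rel :: "nat \<Rightarrow> nat \<Rightarrow> (nat \<Rightarrow> nat \<Rightarrow> bool) \<Rightarrow> nat \<Rightarrow> nat \<Rightarrow> bool" where
  "lift_rel u t S p q \<longleftrightarrow> p div u = q div t \<and> S (p mod u) (q mod t)"

lemma partial_inj_lift_rel:
  assumes "partial_inj S"
  shows "partial_inj (lift_rel u t S)"
  using assms unfolding partial_inj_def lift_rel_def by (metis div_mult_mod_eq)

text \<open>The lifted relations connect only positions with the same level index, so the product
  acts inside each block separately and leaves the pair of level indices unchanged.\<close>

lemma lift_rel_sandwich:
  assumes S: "partial_inj S" and S': "partial_inj S'" and x: "\<And>i j. x i j \<in> carrier_mat t t'"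
  shows "rel_mat (N_of n * u) (N_of n * t) (lift_rel u t S) * level_mat n t t' x *
      rel_mat (N_of n * t') (N_of n * u') (lift_rel t' u' S') =
    level_mat n u u' (\<lambda>i j. rel_mat u t S * x i j * rel_mat t' u' S')" (is "?L = ?R")
proof (rule eq_matI)
  fix p q assume "p < dim_row ?R" "q < dim_col ?R"
  hence p: "p < N_of n * u" and q: "q < N_of n * u'" by auto
  note dp = less_mult_imp_div_less[OF p] and mp = mod_less_of_less_mult[OF p]
    and dq = less_mult_imp_div_less[OF q] and mq = mod_less_of_less_mult[OF q]
  let ?x = "x (multi_index n (p div u)) (multi_index n (q div u'))"
  have R: "?R $$ (p, q) = (rel_mat u t S * ?x * rel_mat t' u' S') $$ (p mod u, q mod u')"
    using p q by (simp add: index_level_mat del: index_mult_mat)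
  note G = partial_inj_lift_rel[OF S, of u t] partial_inj_lift_rel[OF S', of t' u']
  consider (both) \<alpha> \<beta> where "\<alpha> < t" "\<beta> < t'" "S (p mod u) \<alpha>" "S' \<beta> (q mod u')"
    | (row) "\<And>\<alpha>. \<alpha> < t \<Longrightarrow> \<not> S (p mod u) \<alpha>"
    | (col) "\<And>\<beta>. \<beta> < t' \<Longrightarrow> \<not> S' \<beta> (q mod u')" by blast
  thus "?L $$ (p, q) = ?R $$ (p, q)"
  proof cases
    case both
    let ?i = "p div u * t + \<alpha>" and ?j = "q div u' * t' + \<beta>"
    have ij: "?i < N_of n * t" "?j < N_of n * t'" using dp dq both by (auto intro: mult_add_less)
    have "?L $$ (p, q) = level_mat n t t' x $$ (?i, ?j)"
      using ij both by (intro rel_mat_sandwich_entry[OF level_mat_carrier p q G]) (auto simp: lift_rel_def)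
    also have "\<dots> = ?x $$ (\<alpha>, \<beta>)" using ij both by (simp add: index_level_mat)
    also have "\<dots> = ?R $$ (p, q)"
      unfolding R using both by (intro rel_mat_sandwich_entry[OF x mp mq S S', symmetric])
    finally show ?thesis .
  next
    case row
    have "?L $$ (p, q) = 0"
      using row by (intro rel_mat_sandwich_zero_row[OF level_mat_carrier p q G])
        (auto simp: lift_rel_def mod_less_of_less_mult)
    thus ?thesis unfolding R using row by (simp add: rel_mat_sandwich_zero_row[OF x mp mq S S'] del: index_mult_mat)
  next
    case col
    have "?L $$ (p, q) = 0"
      using col by (intro rel_mat_sandwich_zero_col[OF level_mat_carrier p q G])
        (auto simp: lift_rel_def mod_less_of_less_mult)
    thus ?thesis unfolding R using col by (simp add: rel_mat_sandwich_zero_col[OF x mp mq S S'] del: index_mult_mat)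
  qed
qed auto

section \<open>Partitions of rows and columns into blocks of varying size\<close>

lemma block_start_Suc: "block_start rr (Suc i) = block_start rr i + rr i"
  and block_start_0 [simp]: "block_start rr 0 = 0"
  by (simp_all add: block_start_def)

lemma block_start_mono: "i \<le> j \<Longrightarrow> block_start rr i \<le> block_start rr j"
  unfolding block_start_def by (intro sum_mono2) auto

lemma block_no_eq:
  assumes "block_start rr i \<le> p" "p < block_start rr (Suc i)"
  shows "block_no rr p = i"
  unfolding block_no_def
proof (rule Least_equality)
  show "p < block_start rr (Suc i)" by (rule assms(2))
next
  fix j assume "p < block_start rr (Suc j)"
  thus "i \<le> j" using assms(1) block_start_mono[of "Suc j" i rr] by (meson leD le_trans not_less_eq_eq)
qed

text \<open>Block \<open>k - 1\<close> ends beyond \<open>p\<close>, so the least number in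
  \<open>block_no\<close> exists and is below \<open>k\<close>. Its minimality means that the
  preceding block ends at or before \<open>p\<close>, which is the lower bound.\<close>

lemma block_no_props:
  assumes "p < block_start rr k"
  shows "block_no rr p < k" "block_start rr (block_no rr p) \<le> p"
    "p < block_start rr (Suc (block_no rr p))"
proof -
  have k: "k \<noteq> 0" using assms by (metis block_start_0 not_less0)
  hence ex: "p < block_start rr (Suc (k - 1))" using assms by simp
  show 1: "p < block_start rr (Suc (block_no rr p))"
    unfolding block_no_def by (rule LeastI[of "\<lambda>i. p < block_start rr (Suc i)", OF ex])
  have "block_no rr p \<le> k - 1"
    unfolding block_no_def by (rule Least_le[of "\<lambda>i. p < block_start rr (Suc i)", OF ex])
  thus "block_no rr p < k" using k by simp
  show "block_start rr (block_no rr p) \<le> p"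
  proof (cases "block_no rr p")
    case (Suc l)
    hence "\<not> p < block_start rr (Suc l)" using not_less_Least[of l "\<lambda>i. p < block_start rr (Suc i)"]
      unfolding block_no_def by simp
    thus ?thesis using Suc by simp
  qed simp
qed

lemma block_no_sum:
  assumes "p < (\<Sum>i<k. rr i)"
  shows "block_no rr p < k" "p - block_start rr (block_no rr p) < rr (block_no rr p)"
    "block_start rr (block_no rr p) \<le> p"
  using block_no_props[of p rr k] assms by (auto simp: block_start_def[of rr k] block_start_Suc)

lemma block_start_add_less: "i < k \<Longrightarrow> \<alpha> < rr i \<Longrightarrow> block_start rr i + \<alpha> < (\<Sum>l<k. rr l)"
  using block_start_mono[of "Suc i" k rr] by (simp add: block_start_Suc block_start_def[of rr k])

lemma block_no_add: "\<alpha> < rr i \<Longrightarrow> block_no rr (block_start rr i + \<alpha>) = i"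
  by (rule block_no_eq) (auto simp: block_start_Suc)

lemma block_array_carrier [simp]: "block_array \<rho> \<sigma> rr ss X \<in> carrier_mat (\<Sum>i<\<rho>. rr i) (\<Sum>j<\<sigma>. ss j)"
  and dim_row_block_array [simp]: "dim_row (block_array \<rho> \<sigma> rr ss X) = (\<Sum>i<\<rho>. rr i)"
  and dim_col_block_array [simp]: "dim_col (block_array \<rho> \<sigma> rr ss X) = (\<Sum>j<\<sigma>. ss j)"
  by (simp_all add: block_array_def)

lemma index_block_array:
  assumes "i < \<rho>" "j < \<sigma>" "\<alpha> < rr i" "\<beta> < ss j"
  shows "block_array \<rho> \<sigma> rr ss X $$ (block_start rr i + \<alpha>, block_start ss j + \<beta>) = X i j $$ (\<alpha>, \<beta>)"
  using assms by (simp add: block_array_def block_start_add_less block_no_add)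

text \<open>The matrix of this relation embeds the coordinates of block \<open>i\<close> into those
  of the whole array, and its transpose extracts them. The bound on \<alpha> excludes padding
  coordinates.\<close>

definition block_rel :: "(nat \<Rightarrow> nat) \<Rightarrow> nat \<Rightarrow> nat \<Rightarrow> nat \<Rightarrow> bool" where
  "block_rel rr i p \<alpha> \<longleftrightarrow> \<alpha> < rr i \<and> p = block_start rr i + \<alpha>"

lemma partial_inj_block_rel: "partial_inj (block_rel rr i)"
  by (auto simp: partial_inj_def block_rel_def)

lemma extend_mat_carrier:
  assumes "x \<in> carrier_mat r s" "r \<le> t" "s \<le> t"
  shows "extend_mat r s t x \<in> carrier_mat t t"
  using assms by (auto simp: extend_mat_def)

lemma index_extend_mat:
  assumes "x \<in> carrier_mat r s" "r \<le> t" "s \<le> t" "p < t" "q < t"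
  shows "extend_mat r s t x $$ (p, q) = (if p < r \<and> q < s then x $$ (p, q) else 0)"
  using assms by (auto simp: extend_mat_def)

text \<open>Extraction of one block, with independent padded sizes \<open>t\<close> and
  \<open>u\<close>. Positions outside the \<open>rr i\<close> by \<open>ss j\<close> corner have no
  partner under \<open>block_rel\<close>, so the product vanishes there, just as the padding
  does.\<close>

lemma extend_mat_block:
  assumes "i < \<rho>" "j < \<sigma>" and X: "X i j \<in> carrier_mat (rr i) (ss j)"
    and t: "(\<Sum>i<\<rho>. rr i) \<le> t" "(\<Sum>j<\<sigma>. ss j) \<le> t" and u: "rr i \<le> u" "ss j \<le> u"
  shows "extend_mat (rr i) (ss j) u (X i j) =
    rel_mat u t (\<lambda>\<alpha> p. block_rel rr i p \<alpha>) *
      extend_mat (\<Sum>i<\<rho>. rr i) (\<Sum>j<\<sigma>. ss j) t (block_array \<rho> \<sigma> rr ss X) * rel_mat t u (block_rel ss j)"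
    (is "?L = ?P * ?X * ?Q")
proof (rule eq_matI)
  fix p q assume "p < dim_row (?P * ?X * ?Q)" "q < dim_col (?P * ?X * ?Q)"
  hence p: "p < u" and q: "q < u" by auto
  have Xc: "?X \<in> carrier_mat t t" using t by (intro extend_mat_carrier) auto
  note G = partial_inj_conversep[OF partial_inj_block_rel[of rr i]] partial_inj_block_rel[of ss j]
  note L = index_extend_mat[OF X u p q]
  show "?L $$ (p, q) = (?P * ?X * ?Q) $$ (p, q)"
  proof (cases "p < rr i \<and> q < ss j")
    case True
    have lt: "block_start rr i + p < (\<Sum>i<\<rho>. rr i)" "block_start ss j + q < (\<Sum>j<\<sigma>. ss j)"
      using True assms by (auto intro: block_start_add_less)
    have "(?P * ?X * ?Q) $$ (p, q) = ?X $$ (block_start rr i + p, block_start ss j + q)"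
      using True lt t by (intro rel_mat_sandwich_entry[OF Xc p q G]) (auto simp: block_rel_def)
    also have "\<dots> = X i j $$ (p, q)"
      using True lt t assms by (simp add: index_extend_mat[OF block_array_carrier] index_block_array)
    finally show ?thesis using True L by simp
  next
    case False
    hence "(?P * ?X * ?Q) $$ (p, q) = 0"
      using rel_mat_sandwich_zero_row[OF Xc p q G] rel_mat_sandwich_zero_col[OF Xc p q G]
      by (cases "p < rr i") (auto simp: block_rel_def simp del: index_mult_mat)
    thus ?thesis using False L by auto
  qed
qed (use extend_mat_carrier[OF X u] in auto)

text \<open>Each position of the array belongs to exactly one block, so exactly one summand can
  contribute to it, and no summand reaches the padding.\<close>

lemma extend_mat_block_array:
  assumes X: "\<And>i j. i < \<rho> \<Longrightarrow> j < \<sigma> \<Longrightarrow> X i j \<in> carrier_mat (rr i) (ss j)"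
    and t: "(\<Sum>i<\<rho>. rr i) \<le> t" "(\<Sum>j<\<sigma>. ss j) \<le> t"
  shows "extend_mat (\<Sum>i<\<rho>. rr i) (\<Sum>j<\<sigma>. ss j) t (block_array \<rho> \<sigma> rr ss X) =
    mat_sum t t (\<lambda>(i, j). rel_mat t t (block_rel rr i) * extend_mat (rr i) (ss j) t (X i j) *
      rel_mat t t (\<lambda>\<beta> q. block_rel ss j q \<beta>)) ({..<\<rho>} \<times> {..<\<sigma>})"
    (is "?L = mat_sum t t ?Y _")
proof (rule eq_matI)
  fix p q assume "p < dim_row (mat_sum t t ?Y ({..<\<rho>} \<times> {..<\<sigma>}))" "q < dim_col (mat_sum t t ?Y ({..<\<rho>} \<times> {..<\<sigma>}))"
  hence p: "p < t" and q: "q < t" by (auto simp: mat_sum_def)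
  have le: "rr i \<le> t" "ss j \<le> t" if "i < \<rho>" "j < \<sigma>" for i j
    using t that member_le_sum[of i "{..<\<rho>}" rr] member_le_sum[of j "{..<\<sigma>}" ss] by auto
  let ?in = "\<lambda>i j. \<exists>\<alpha> \<beta>. block_rel rr i p \<alpha> \<and> block_rel ss j q \<beta>"
  have Y: "?Y (i, j) $$ (p, q) =
      (if ?in i j then X i j $$ (p - block_start rr i, q - block_start ss j) else 0)"
    if ij: "i < \<rho>" "j < \<sigma>" for i j
  proof -
    note Xc = extend_mat_carrier[OF X[OF ij] le[OF ij]]
    note G = partial_inj_block_rel[of rr i] partial_inj_conversep[OF partial_inj_block_rel[of ss j]]
    show ?thesis
    proof (cases "?in i j")
      case True
      then obtain \<alpha> \<beta> where ab: "block_rel rr i p \<alpha>" "block_rel ss j q \<beta>" by blast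
      hence "\<alpha> < rr i" "\<beta> < ss j" "\<alpha> = p - block_start rr i" "\<beta> = q - block_start ss j"
        by (auto simp: block_rel_def)
      thus ?thesis using ab True le[OF ij] rel_mat_sandwich_entry[OF Xc p q G, of \<alpha> \<beta>]
          index_extend_mat[OF X[OF ij] le[OF ij]] by (simp del: index_mult_mat)
    next
      case False
      thus ?thesis using rel_mat_sandwich_zero_row[OF Xc p q G] rel_mat_sandwich_zero_col[OF Xc p q G]
        by (auto simp del: index_mult_mat)
    qed
  qed
  have R: "mat_sum t t ?Y ({..<\<rho>} \<times> {..<\<sigma>}) $$ (p, q) = (\<Sum>i<\<rho>. \<Sum>j<\<sigma>. ?Y (i, j) $$ (p, q))"
    using p q by (simp add: mat_sum_def sum.cartesian_product case_prod_beta del: index_mult_mat)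
  show "?L $$ (p, q) = mat_sum t t ?Y ({..<\<rho>} \<times> {..<\<sigma>}) $$ (p, q)"
  proof (cases "p < (\<Sum>i<\<rho>. rr i) \<and> q < (\<Sum>j<\<sigma>. ss j)")
    case True
    let ?i = "block_no rr p" and ?j = "block_no ss q"
    from True have lp: "p < (\<Sum>i<\<rho>. rr i)" and lq: "q < (\<Sum>j<\<sigma>. ss j)" by auto
    note bp = block_no_sum[OF lp] and bq = block_no_sum[OF lq]
    have iff: "?in i j \<longleftrightarrow> i = ?i \<and> j = ?j" for i j
    proof
      assume "i = ?i \<and> j = ?j"
      hence "block_rel rr i p (p - block_start rr i)" "block_rel ss j q (q - block_start ss j)"
        using bp bq by (auto simp: block_rel_def)
      thus "?in i j" by blast
    qed (auto simp: block_rel_def block_no_add)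
    \<comment> \<open>The conjunction is split into nested conditionals so that the two sums
      collapse one after the other.\<close>
    have Y': "?Y (i, j) $$ (p, q) = (if i = ?i then if j = ?j
        then X i j $$ (p - block_start rr i, q - block_start ss j) else 0 else 0)"
      if "i < \<rho>" "j < \<sigma>" for i j
      unfolding Y[OF that] iff by simp
    have "(\<Sum>i<\<rho>. \<Sum>j<\<sigma>. ?Y (i, j) $$ (p, q)) = (\<Sum>i<\<rho>. \<Sum>j<\<sigma>. if i = ?i then if j = ?j
        then X i j $$ (p - block_start rr i, q - block_start ss j) else 0 else 0)"
      by (intro sum.cong refl Y') auto
    also have "\<dots> = (\<Sum>i<\<rho>. if i = ?i then \<Sum>j<\<sigma>. if j = ?j
        then X i j $$ (p - block_start rr i, q - block_start ss j) else 0 else 0)"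
      by (intro sum.cong refl) simp
    also have "\<dots> = X ?i ?j $$ (p - block_start rr ?i, q - block_start ss ?j)"
      using bp bq by simp
    also have "\<dots> = ?L $$ (p, q)"
      unfolding index_extend_mat[OF block_array_carrier t p q] using True by (simp add: block_array_def)
    finally show ?thesis using R by simp
  next
    case False
    have notin: "\<not> ?in i j" if "i < \<rho>" "j < \<sigma>" for i j
      using False that block_start_add_less[of i \<rho> _ rr] block_start_add_less[of j \<sigma> _ ss]
      by (auto simp: block_rel_def)
    hence "?Y (i, j) $$ (p, q) = 0" if "i < \<rho>" "j < \<sigma>" for i j
      by (simp only: Y[OF that] notin[OF that] if_False)
    hence "(\<Sum>i<\<rho>. \<Sum>j<\<sigma>. ?Y (i, j) $$ (p, q)) = 0"
      by (intro sum.neutral ballI) (simp del: index_mult_mat)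
    thus ?thesis using R False p q t by (auto simp: index_extend_mat[OF block_array_carrier])
  qed
qed (use extend_mat_carrier[OF block_array_carrier t] in \<open>auto simp: mat_sum_def\<close>)

section \<open>Approximating sequences\<close>

lemma block_start_const: "block_start (\<lambda>_. s) i = i * s"
  by (simp add: block_start_def)

lemma block_no_const: "0 < s \<Longrightarrow> block_no (\<lambda>_. s) p = p div s"
  using dividend_less_div_times[of s p] by (intro block_no_eq) (simp_all add: block_start_const)

text \<open>\<open>diag_block_mat\<close> is recursive, whereas entries of a block array can be read
  off directly. This serves both the sampling matrices and the diagonal of transposed permutation
  matrices.\<close>

lemma diag_block_mat_eq_block_array:
  assumes "\<And>i. i < k \<Longrightarrow> X i \<in> carrier_mat (rr i) (ss i)"
  shows "diag_block_mat (map X [0..<k]) = block_array k k rr ss (\<lambda>i j. if i = j then X i else 0\<^sub>m (rr i) (ss j))"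
  using assms
proof (induction k)
  case 0
  show ?case by (rule eq_matI) auto
next
  case (Suc k)
  let ?Z = "\<lambda>i j. if i = j then X i else 0\<^sub>m (rr i) (ss j)"
  have IH: "diag_block_mat (map X [0..<k]) = block_array k k rr ss ?Z" using Suc by simp
  have Xk: "X k \<in> carrier_mat (rr k) (ss k)" using Suc.prems by simp
  \<comment> \<open>The last block is split off, because then the block numbers and block starts of
    the earlier rows and columns stay the same.\<close>
  have eq: "diag_block_mat (map X [0..<Suc k]) = four_block_mat (block_array k k rr ss ?Z)
      (0\<^sub>m (\<Sum>i<k. rr i) (ss k)) (0\<^sub>m (rr k) (\<Sum>i<k. ss i)) (X k)"
    using Xk by (simp add: diag_block_mat_last IH Let_def)
  show ?case unfolding eq
  proof (rule eq_matI)
    fix p q assume "p < dim_row (block_array (Suc k) (Suc k) rr ss ?Z)" "q < dim_col (block_array (Suc k) (Suc k) rr ss ?Z)"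
    hence p: "p < (\<Sum>i<Suc k. rr i)" and q: "q < (\<Sum>j<Suc k. ss j)" by auto
    have low: "block_no rr p < k" if "p < (\<Sum>i<k. rr i)" for rr p using block_no_sum(1)[OF that] .
    have high: "block_no rr p = k \<and> block_start rr k = (\<Sum>i<k. rr i) \<and> p - (\<Sum>i<k. rr i) < rr k"
      if "\<not> p < (\<Sum>i<k. rr i)" "p < (\<Sum>i<Suc k. rr i)" for rr p
      using that block_no_eq[of rr k p] by (auto simp: block_start_def)
    have bp: "p - block_start rr (block_no rr p) < rr (block_no rr p)"
      and bq: "q - block_start ss (block_no ss q) < ss (block_no ss q)"
      using block_no_sum(2)[OF p] block_no_sum(2)[OF q] by auto
    show "four_block_mat (block_array k k rr ss ?Z) (0\<^sub>m (\<Sum>i<k. rr i) (ss k)) (0\<^sub>m (rr k) (\<Sum>i<k. ss i)) (X k)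
        $$ (p, q) = block_array (Suc k) (Suc k) rr ss ?Z $$ (p, q)"
      using p q Xk low[of p rr] low[of q ss] high[of p rr] high[of q ss] bp bq
      by (cases "p < (\<Sum>i<k. rr i)"; cases "q < (\<Sum>j<k. ss j)") (auto simp: block_array_def)
  qed (use Xk in auto)
qed

section \<open>Sampling and Toeplitz matrices of single monomials\<close>

lemma sampling_mat_scalar:
  "sampling_mat n (\<lambda>x. a x \<cdot>\<^sub>m 1\<^sub>m s) \<in> carrier_mat (N_of n * s) (N_of n * s)" (is ?C)
  "p < N_of n * s \<Longrightarrow> q < N_of n * s \<Longrightarrow> sampling_mat n (\<lambda>x. a x \<cdot>\<^sub>m 1\<^sub>m s) $$ (p, q) =
     (if p = q then a (\<chi> k. real (multi_index n (p div s) k) / real (n k)) else 0)"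
proof -
  have eq: "sampling_mat n (\<lambda>x. a x \<cdot>\<^sub>m 1\<^sub>m s) = block_array (N_of n) (N_of n) (\<lambda>_. s) (\<lambda>_. s)
    (\<lambda>i j. if i = j then a (\<chi> k. real (multi_index n i k) / real (n k)) \<cdot>\<^sub>m 1\<^sub>m s else 0\<^sub>m s s)"
    unfolding sampling_mat_def by (rule diag_block_mat_eq_block_array) simp
  show ?C unfolding eq using block_array_carrier[of "N_of n" "N_of n" "\<lambda>_. s" "\<lambda>_. s"] by simp
  assume p: "p < N_of n * s" and q: "q < N_of n * s"
  hence s: "0 < s" by (cases s) auto
  have mod: "p - p div s * s = p mod s" for p by (rule minus_div_mult_eq_mod)
  have pq: "p = q \<longleftrightarrow> p div s = q div s \<and> p mod s = q mod s" by (metis div_mult_mod_eq)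
  show "sampling_mat n (\<lambda>x. a x \<cdot>\<^sub>m 1\<^sub>m s) $$ (p, q) =
     (if p = q then a (\<chi> k. real (multi_index n (p div s) k) / real (n k)) else 0)"
    unfolding eq block_array_def using p q s
    by (simp add: block_no_const block_start_const mod pq)
qed

text \<open>The Fourier coefficient with index \<open>k\<close> of the scalar monomial of frequency
  \<open>j\<close>. It stays an unevaluated integral, since what matters is that it is a scalar
  factor in front of a constant matrix.\<close>

definition scalar_coeff :: "('d::finite \<Rightarrow> int) \<Rightarrow> ('d \<Rightarrow> int) \<Rightarrow> complex" where
  "scalar_coeff j k = (LINT \<theta>:cbox (\<chi> l. - pi) (\<chi> l. pi)|lebesgue.
     exp (\<i> * of_real (freq_dot j \<theta>)) * exp (- \<i> * of_real (freq_dot k \<theta>))) / (2 * of_real pi) ^ CARD('d)"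

lemma unit_mat_carrier [simp]: "unit_mat s \<alpha> \<beta> \<in> carrier_mat s s"
  and dim_row_unit_mat [simp]: "dim_row (unit_mat s \<alpha> \<beta>) = s"
  and dim_col_unit_mat [simp]: "dim_col (unit_mat s \<alpha> \<beta>) = s"
  and index_unit_mat: "p < s \<Longrightarrow> q < s \<Longrightarrow> unit_mat s \<alpha> \<beta> $$ (p, q) = (if p = \<alpha> \<and> q = \<beta> then 1 else 0)"
  by (simp_all add: unit_mat_def)

lemma fourier_coeff_monomial:
  "fourier_coeff s s (\<lambda>\<theta>. exp (\<i> * of_real (freq_dot j \<theta>)) \<cdot>\<^sub>m unit_mat s \<alpha> \<beta>) k =
    scalar_coeff j k \<cdot>\<^sub>m unit_mat s \<alpha> \<beta>"
  by (rule eq_matI) (auto simp: fourier_coeff_def scalar_coeff_def index_unit_mat set_lebesgue_integral_def)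

text \<open>The sampling matrix is diagonal and constant on each level block, so it only scales the
  block rows of the Toeplitz matrix. Thus every block of the product is a scalar times the same
  matrix unit, and a level-wise sandwich has to be computed for that matrix unit only.\<close>

lemma sampling_toeplitz_monomial:
  "sampling_mat n (\<lambda>x. a x \<cdot>\<^sub>m 1\<^sub>m s) *
      toeplitz_mat n s s (\<lambda>\<theta>. exp (\<i> * of_real (freq_dot j \<theta>)) \<cdot>\<^sub>m unit_mat s \<alpha> \<beta>) =
    level_mat n s s (\<lambda>k l. (a (\<chi> m. real (k m) / real (n m)) * scalar_coeff j (\<lambda>m. int (k m) - int (l m)))
      \<cdot>\<^sub>m unit_mat s \<alpha> \<beta>)" (is "?D * ?T = ?R")
proof (rule eq_matI)
  note D = sampling_mat_scalar(1)[of n a s]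
  have T: "?T = level_mat n s s (\<lambda>k l. scalar_coeff j (\<lambda>m. int (k m) - int (l m)) \<cdot>\<^sub>m unit_mat s \<alpha> \<beta>)"
    by (simp add: toeplitz_mat_def fourier_coeff_monomial)
  fix p q assume "p < dim_row ?R" "q < dim_col ?R"
  hence p: "p < N_of n * s" and q: "q < N_of n * s" by auto
  have "(?D * ?T) $$ (p, q) = (\<Sum>i<N_of n * s. ?D $$ (p, i) * ?T $$ (i, q))"
    using p q D unfolding T by (simp add: scalar_prod_def lessThan_atLeast0)
  also have "\<dots> = (\<Sum>i<N_of n * s. if i = p then a (\<chi> k. real (multi_index n (p div s) k) / real (n k)) * ?T $$ (i, q) else 0)"
    by (intro sum.cong refl) (use p in \<open>auto simp: sampling_mat_scalar(2)\<close>)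
  also have "\<dots> = ?R $$ (p, q)"
    using p q by (simp add: T index_level_mat mod_less_of_less_mult)
  finally show "(?D * ?T) $$ (p, q) = ?R $$ (p, q)" .
qed (use sampling_mat_scalar(1)[of n a s] in \<open>auto simp: toeplitz_mat_def\<close>)

text \<open>The product is column \<alpha> of the left factor times row \<beta> of the right factor.
  Each of them contains at most one 1, so the result is a matrix unit or zero.\<close>

lemma rel_mat_unit_mat:
  assumes S: "partial_inj S" and S': "partial_inj S'" and "\<alpha> < t" "\<beta> < t"
  shows "S p0 \<alpha> \<Longrightarrow> S' \<beta> q0 \<Longrightarrow>
      rel_mat u t S * unit_mat t \<alpha> \<beta> * rel_mat t u S' = unit_mat u p0 q0" (is "_ \<Longrightarrow> _ \<Longrightarrow> ?L = ?R")
    and "\<not> (\<exists>p<u. \<exists>q<u. S p \<alpha> \<and> S' \<beta> q) \<Longrightarrow>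
      rel_mat u t S * unit_mat t \<alpha> \<beta> * rel_mat t u S' = 0\<^sub>m u u"
proof -
  have entry: "?L $$ (p, q) = of_bool (S p \<alpha>) * of_bool (S' \<beta> q)" if "p < u" "q < u" for p q
  proof -
    have "?L $$ (p, q) = (\<Sum>i<t. \<Sum>j<t. if i = \<alpha> then if j = \<beta> then of_bool (S p i) * of_bool (S' j q) else 0 else 0)"
      unfolding index_mult3[OF rel_mat_carrier unit_mat_carrier rel_mat_carrier that]
      by (intro sum.cong refl) (use that in \<open>auto simp: index_rel_mat index_unit_mat\<close>)
    also have "\<dots> = (\<Sum>i<t. if i = \<alpha> then \<Sum>j<t. if j = \<beta> then of_bool (S p i) * of_bool (S' j q) else 0 else 0)"
      by (intro sum.cong refl) simp
    also have "\<dots> = of_bool (S p \<alpha>) * of_bool (S' \<beta> q)" using assms(3,4) by simp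
    finally show ?thesis .
  qed
  show "?L = ?R" if *: "S p0 \<alpha>" "S' \<beta> q0"
  proof (rule eq_matI)
    fix p q assume "p < dim_row ?R" "q < dim_col ?R"
    hence pq: "p < u" "q < u" by auto
    have "S p \<alpha> \<longleftrightarrow> p = p0" "S' \<beta> q \<longleftrightarrow> q = q0" using * S S' unfolding partial_inj_def by blast+
    thus "?L $$ (p, q) = ?R $$ (p, q)" unfolding entry[OF pq] using pq by (simp add: index_unit_mat)
  qed auto
  show "?L = 0\<^sub>m u u" if "\<not> (\<exists>p<u. \<exists>q<u. S p \<alpha> \<and> S' \<beta> q)"
  proof (rule eq_matI)
    fix p q assume "p < dim_row (0\<^sub>m u u :: complex mat)" "q < dim_col (0\<^sub>m u u :: complex mat)"
    hence pq: "p < u" "q < u" by auto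
    show "?L $$ (p, q) = 0\<^sub>m u u $$ (p, q)" unfolding entry[OF pq] using pq that by auto
  qed auto
qed

lemma trig_monomial_carrier: "f \<in> trig_monomials s \<Longrightarrow> f \<theta> \<in> carrier_mat s s"
  by (auto simp: trig_monomials_def)

lemma sampling_toeplitz_carrier:
  "sampling_mat n (\<lambda>x. a x \<cdot>\<^sub>m 1\<^sub>m s) * toeplitz_mat n s s f \<in> carrier_mat (N_of n * s) (N_of n * s)"
  by (rule mult_carrier_mat[OF sampling_mat_scalar(1)]) (simp add: toeplitz_mat_def)

text \<open>Pairs of a symbol \<open>\<Sum>\<^sub>i a\<^sub>i(x) f\<^sub>i(\<theta>)\<close> and the corresponding matrix-sequence
  \<open>\<Sum>\<^sub>i D\<^sub>n(a\<^sub>i I\<^sub>s) T\<^sub>n(f\<^sub>i)\<close>, with the terms added one at a time to allow proofs by rule induction.\<close>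

inductive glt_poly ::
    "(nat \<Rightarrow> 'd::{finite,linorder} \<Rightarrow> nat) \<Rightarrow> nat \<Rightarrow>
     ((real ^ 'd::{finite,linorder}) \<times> (real ^ 'd::{finite,linorder}) \<Rightarrow> complex mat) \<Rightarrow> (nat \<Rightarrow> complex mat) \<Rightarrow> bool"
  for \<nu> s where
  zero: "glt_poly \<nu> s (\<lambda>z. 0\<^sub>m s s) (\<lambda>n. 0\<^sub>m (N_of (\<nu> n) * s) (N_of (\<nu> n) * s))"
| add: "glt_poly \<nu> s F B \<Longrightarrow> smooth_on_cube a \<Longrightarrow> f \<in> trig_monomials s \<Longrightarrow>
    glt_poly \<nu> s (\<lambda>z. F z + a (fst z) \<cdot>\<^sub>m f (snd z))
      (\<lambda>n. B n + sampling_mat (\<nu> n) (\<lambda>x. a x \<cdot>\<^sub>m 1\<^sub>m s) * toeplitz_mat (\<nu> n) s s f)"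

lemma glt_poly_carrier:
  assumes "glt_poly \<nu> s F B"
  shows "F z \<in> carrier_mat s s" "B n \<in> carrier_mat (N_of (\<nu> n) * s) (N_of (\<nu> n) * s)"
  using assms by (induction) (auto intro!: add_carrier_mat smult_carrier_mat sampling_toeplitz_carrier dest: trig_monomial_carrier)

lemma mat_sum_empty [simp]: "mat_sum nr nc X {} = 0\<^sub>m nr nc"
  by (rule eq_matI) (auto simp: mat_sum_def)

lemma mat_sum_insert:
  assumes "finite S" "x \<notin> S" "X x \<in> carrier_mat nr nc"
  shows "mat_sum nr nc X (insert x S) = mat_sum nr nc X S + X x"
  using assms by (intro eq_matI) (auto simp: mat_sum_def)

lemma mat_sum_Suc:
  "X k \<in> carrier_mat nr nc \<Longrightarrow> mat_sum nr nc X {..<Suc k} = mat_sum nr nc X {..<k} + X k"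
  using mat_sum_insert[of "{..<k}" k X nr nc] by (simp add: lessThan_Suc)

lemma mat_sum_cong: "(\<And>i. i \<in> S \<Longrightarrow> X i = Y i) \<Longrightarrow> mat_sum nr nc X S = mat_sum nr nc Y S"
  by (simp add: mat_sum_def cong: sum.cong)

lemma glt_poly_iff:
  "glt_poly \<nu> s F B \<longleftrightarrow> (\<exists>(M::nat) a f. (\<forall>i<M. smooth_on_cube (a i) \<and> f i \<in> trig_monomials s) \<and>
     F = (\<lambda>z. mat_sum s s (\<lambda>i. a i (fst z) \<cdot>\<^sub>m f i (snd z)) {..<M}) \<and>
     B = (\<lambda>n. mat_sum (N_of (\<nu> n) * s) (N_of (\<nu> n) * s)
       (\<lambda>i. sampling_mat (\<nu> n) (\<lambda>x. a i x \<cdot>\<^sub>m 1\<^sub>m s) * toeplitz_mat (\<nu> n) s s (f i)) {..<M}))"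
    (is "_ \<longleftrightarrow> (\<exists>(M::nat) a f. ?P M a f \<and> F = ?F M a f \<and> B = ?B M a f)")
proof
  assume "glt_poly \<nu> s F B"
  thus "\<exists>M a f. ?P M a f \<and> F = ?F M a f \<and> B = ?B M a f"
  proof induction
    case zero
    show ?case by (rule exI[of _ 0]) simp
  next
    case (add F B b g)
    then obtain M a f where *: "?P M a f" "F = ?F M a f" "B = ?B M a f" by blast
    \<comment> \<open>The sums reach only below \<open>M\<close>, so the new term can be stored at
      index \<open>M\<close> without changing the old ones.\<close>
    let ?a = "a(M := b)" and ?f = "f(M := g)"
    have "?P (Suc M) ?a ?f" using * add by (auto simp: less_Suc_eq)
    moreover have "(\<lambda>z. F z + b (fst z) \<cdot>\<^sub>m g (snd z)) = ?F (Suc M) ?a ?f"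
      using add by (auto simp: *(2) mat_sum_Suc trig_monomial_carrier intro!: mat_sum_cong arg_cong2[where f = "(+)"])
    moreover have "(\<lambda>n. B n + sampling_mat (\<nu> n) (\<lambda>x. b x \<cdot>\<^sub>m 1\<^sub>m s) * toeplitz_mat (\<nu> n) s s g) = ?B (Suc M) ?a ?f"
      by (auto simp: *(3) mat_sum_Suc sampling_toeplitz_carrier intro!: mat_sum_cong arg_cong2[where f = "(+)"])
    ultimately show ?case by blast
  qed
next
  assume "\<exists>M a f. ?P M a f \<and> F = ?F M a f \<and> B = ?B M a f"
  then obtain M a f where *: "?P M a f" "F = ?F M a f" "B = ?B M a f" by blast
  \<comment> \<open>The induction runs over partial sums of the fixed families, so the assumption on
    all indices below \<open>M\<close> remains available.\<close>
  have "glt_poly \<nu> s (?F k a f) (?B k a f)" if "k \<le> M" for k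
    using that
  proof (induction k)
    case 0
    show ?case using glt_poly.zero by simp
  next
    case (Suc k)
    have k: "smooth_on_cube (a k)" "f k \<in> trig_monomials s" using *(1) Suc.prems by auto
    have "glt_poly \<nu> s (?F k a f) (?B k a f)" using Suc by simp
    from glt_poly.add[OF this k] show ?case
      using k by (simp add: mat_sum_Suc sampling_toeplitz_carrier trig_monomial_carrier)
  qed
  thus "glt_poly \<nu> s F B" using * by simp
qed

lemma square_GLT_iff:
  "square_GLT I \<nu> s A \<kappa> \<longleftrightarrow> (\<exists>F B. (\<forall>m. glt_poly \<nu> s (F m) (B m)) \<and>
     (AE z in lebesgue_on symbol_domain. \<forall>\<alpha><s. \<forall>\<beta><s. (\<lambda>m. F m z $$ (\<alpha>, \<beta>)) \<longlonglongrightarrow> \<kappa> z $$ (\<alpha>, \<beta>)) \<and>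
     acs I (\<lambda>n. N_of (\<nu> n) * s) (\<lambda>n. N_of (\<nu> n) * s) B A)"
  (is "?L \<longleftrightarrow> ?R")
proof
  assume ?L
  then obtain M :: "nat \<Rightarrow> nat" and a f where *: "\<forall>m. \<forall>i<M m. smooth_on_cube (a m i) \<and> f m i \<in> trig_monomials s"
    and **: "AE z in lebesgue_on symbol_domain. \<forall>\<alpha><s. \<forall>\<beta><s.
        (\<lambda>m. mat_sum s s (\<lambda>i. a m i (fst z) \<cdot>\<^sub>m f m i (snd z)) {..<M m} $$ (\<alpha>, \<beta>)) \<longlonglongrightarrow> \<kappa> z $$ (\<alpha>, \<beta>)"
      "acs I (\<lambda>n. N_of (\<nu> n) * s) (\<lambda>n. N_of (\<nu> n) * s)
        (\<lambda>m n. mat_sum (N_of (\<nu> n) * s) (N_of (\<nu> n) * s)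
          (\<lambda>i. sampling_mat (\<nu> n) (\<lambda>x. a m i x \<cdot>\<^sub>m 1\<^sub>m s) * toeplitz_mat (\<nu> n) s s (f m i)) {..<M m}) A"
    unfolding square_GLT_def by (elim exE conjE) (rule that, assumption+)
  have "glt_poly \<nu> s (\<lambda>z. mat_sum s s (\<lambda>i. a m i (fst z) \<cdot>\<^sub>m f m i (snd z)) {..<M m})
      (\<lambda>n. mat_sum (N_of (\<nu> n) * s) (N_of (\<nu> n) * s)
        (\<lambda>i. sampling_mat (\<nu> n) (\<lambda>x. a m i x \<cdot>\<^sub>m 1\<^sub>m s) * toeplitz_mat (\<nu> n) s s (f m i)) {..<M m})" for m
    unfolding glt_poly_iff using * by blast
  with ** show ?R
    by (intro exI[of _ "\<lambda>m z. mat_sum s s (\<lambda>i. a m i (fst z) \<cdot>\<^sub>m f m i (snd z)) {..<M m}"]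
        exI[of _ "\<lambda>m n. mat_sum (N_of (\<nu> n) * s) (N_of (\<nu> n) * s)
          (\<lambda>i. sampling_mat (\<nu> n) (\<lambda>x. a m i x \<cdot>\<^sub>m 1\<^sub>m s) * toeplitz_mat (\<nu> n) s s (f m i)) {..<M m}"]
        conjI allI)
next
  assume ?R
  then obtain F B where *: "\<And>m. glt_poly \<nu> s (F m) (B m)"
    "AE z in lebesgue_on symbol_domain. \<forall>\<alpha><s. \<forall>\<beta><s. (\<lambda>m. F m z $$ (\<alpha>, \<beta>)) \<longlonglongrightarrow> \<kappa> z $$ (\<alpha>, \<beta>)"
    "acs I (\<lambda>n. N_of (\<nu> n) * s) (\<lambda>n. N_of (\<nu> n) * s) B A" by blast
  \<comment> \<open>The conditions are folded into one predicate, so that number, coefficients and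
    monomials can be chosen simultaneously for all \<open>m\<close>.\<close>
  define rep where "rep F B M a f \<longleftrightarrow> (\<forall>i<M. smooth_on_cube (a i) \<and> f i \<in> trig_monomials s) \<and>
     F = (\<lambda>z. mat_sum s s (\<lambda>i. a i (fst z) \<cdot>\<^sub>m f i (snd z)) {..<M}) \<and>
     B = (\<lambda>n. mat_sum (N_of (\<nu> n) * s) (N_of (\<nu> n) * s)
       (\<lambda>i. sampling_mat (\<nu> n) (\<lambda>x. a i x \<cdot>\<^sub>m 1\<^sub>m s) * toeplitz_mat (\<nu> n) s s (f i)) {..<M})"
    for F B and M :: nat and a f
  have "\<exists>M a f. rep (F m) (B m) M a f" for m
    using *(1)[of m] unfolding glt_poly_iff rep_def .
  then obtain M a f where rep: "\<And>m. rep (F m) (B m) (M m) (a m) (f m)" by metis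
  from rep have
    1: "\<And>m. \<forall>i<M m. smooth_on_cube (a m i) \<and> f m i \<in> trig_monomials s" and
    2: "\<And>m. F m = (\<lambda>z. mat_sum s s (\<lambda>i. a m i (fst z) \<cdot>\<^sub>m f m i (snd z)) {..<M m})" and
    3: "\<And>m. B m = (\<lambda>n. mat_sum (N_of (\<nu> n) * s) (N_of (\<nu> n) * s)
       (\<lambda>i. sampling_mat (\<nu> n) (\<lambda>x. a m i x \<cdot>\<^sub>m 1\<^sub>m s) * toeplitz_mat (\<nu> n) s s (f m i)) {..<M m})"
    unfolding rep_def by simp_all
  have B: "B = (\<lambda>m n. mat_sum (N_of (\<nu> n) * s) (N_of (\<nu> n) * s)
       (\<lambda>i. sampling_mat (\<nu> n) (\<lambda>x. a m i x \<cdot>\<^sub>m 1\<^sub>m s) * toeplitz_mat (\<nu> n) s s (f m i)) {..<M m})"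
    using 3 by (rule ext)
  show ?L unfolding square_GLT_def
    using allI[OF 1] *(2,3) unfolding 2 B by (intro exI[of _ M] exI[of _ a] exI[of _ f] conjI)
qed

section \<open>Closure properties of GLT sequences\<close>

lemma add_sandwich_mat:
  fixes X Y :: "complex mat"
  assumes "P \<in> carrier_mat m n" "X \<in> carrier_mat n k" "Y \<in> carrier_mat n k" "Q \<in> carrier_mat k l"
  shows "P * (X + Y) * Q = P * X * Q + P * Y * Q"
  using mult_add_distrib_mat[OF assms(1-3)] add_mult_distrib_mat[of "P * X" m k "P * Y" Q l] assms by simp

lemma smult_sandwich_mat:
  fixes X :: "complex mat"
  assumes "P \<in> carrier_mat m n" "X \<in> carrier_mat n k" "Q \<in> carrier_mat k l"
  shows "P * (c \<cdot>\<^sub>m X) * Q = c \<cdot>\<^sub>m (P * X * Q)"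
  using mult_smult_distrib[OF assms(1,2), of c] mult_smult_assoc_mat[of "P * X" m k Q l c] assms by simp

lemma smult_smult_mat: "a \<cdot>\<^sub>m (b \<cdot>\<^sub>m X) = (a * b) \<cdot>\<^sub>m (X :: complex mat)"
  by (rule eq_matI) auto

lemma glt_poly_add:
  assumes F: "glt_poly \<nu> s F B" and "glt_poly \<nu> s G C"
  shows "glt_poly \<nu> s (\<lambda>z. F z + G z) (\<lambda>n. B n + C n)"
  using assms(2)
proof induction
  case zero
  show ?case using glt_poly_carrier[OF F] F by (simp add: right_add_zero_mat[of _ _ _])
next
  case (add G C a f)
  have *: "(\<lambda>z. F z + (G z + a (fst z) \<cdot>\<^sub>m f (snd z))) = (\<lambda>z. F z + G z + a (fst z) \<cdot>\<^sub>m f (snd z))"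
  proof
    fix z
    show "F z + (G z + a (fst z) \<cdot>\<^sub>m f (snd z)) = F z + G z + a (fst z) \<cdot>\<^sub>m f (snd z)"
      using glt_poly_carrier(1)[OF F] glt_poly_carrier(1)[OF add(1)] trig_monomial_carrier[OF add(3)]
      by (intro assoc_add_mat[symmetric, of _ s s]) auto
  qed
  have **: "(\<lambda>n. B n + (C n + sampling_mat (\<nu> n) (\<lambda>x. a x \<cdot>\<^sub>m 1\<^sub>m s) * toeplitz_mat (\<nu> n) s s f)) =
      (\<lambda>n. B n + C n + sampling_mat (\<nu> n) (\<lambda>x. a x \<cdot>\<^sub>m 1\<^sub>m s) * toeplitz_mat (\<nu> n) s s f)"
    using assoc_add_mat[OF glt_poly_carrier(2)[OF F] glt_poly_carrier(2)[OF add(1)] sampling_toeplitz_carrier]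
    by simp
  show ?case unfolding * ** by (rule glt_poly.add[OF add.IH add(2,3)])
qed

abbreviation lift_mat :: "('d::finite \<Rightarrow> nat) \<Rightarrow> nat \<Rightarrow> nat \<Rightarrow> (nat \<Rightarrow> nat \<Rightarrow> bool) \<Rightarrow> complex mat" where
  "lift_mat n u t S \<equiv> rel_mat (N_of n * u) (N_of n * t) (lift_rel u t S)"

text \<open>The core of the argument. By \<open>sampling_toeplitz_monomial\<close>, the scalars in
  each block pass through the lifted multipliers, and only the matrix unit changes. Symbol and
  matrix-sequence change in the same way, so they remain a corresponding pair.\<close>

lemma glt_poly_sandwich:
  assumes "glt_poly \<nu> t F B" and S: "partial_inj S" and S': "partial_inj S'"
  shows "glt_poly \<nu> u (\<lambda>z. rel_mat u t S * F z * rel_mat t u S')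
    (\<lambda>n. lift_mat (\<nu> n) u t S * B n * lift_mat (\<nu> n) t u S')"
  using assms(1)
proof induction
  case zero
  have *: "(\<lambda>z. rel_mat u t S * 0\<^sub>m t t * rel_mat t u S') = (\<lambda>z. 0\<^sub>m u u)"
    by (simp add: right_mult_zero_mat[OF rel_mat_carrier] left_mult_zero_mat[OF rel_mat_carrier])
  have **: "(\<lambda>n. lift_mat (\<nu> n) u t S * 0\<^sub>m (N_of (\<nu> n) * t) (N_of (\<nu> n) * t) * lift_mat (\<nu> n) t u S') =
      (\<lambda>n. 0\<^sub>m (N_of (\<nu> n) * u) (N_of (\<nu> n) * u))"
    by (simp add: right_mult_zero_mat[OF rel_mat_carrier] left_mult_zero_mat[OF rel_mat_carrier])
  show ?case unfolding * ** by (rule glt_poly.zero)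
next
  case (add F B a f)
  let ?F = "\<lambda>z. rel_mat u t S * F z * rel_mat t u S'"
  let ?B = "\<lambda>n. lift_mat (\<nu> n) u t S * B n * lift_mat (\<nu> n) t u S'"
  let ?ST = "\<lambda>n. sampling_mat (\<nu> n) (\<lambda>x. a x \<cdot>\<^sub>m 1\<^sub>m t) * toeplitz_mat (\<nu> n) t t f"
  let ?st = "\<lambda>n j k l. a (\<chi> m. real (k m) / real (\<nu> n m)) * scalar_coeff j (\<lambda>m. int (k m) - int (l m))"
  from add(3) obtain j \<alpha> \<beta> where ab: "\<alpha> < t" "\<beta> < t"
    and f: "f = (\<lambda>\<theta>. exp (\<i> * of_real (freq_dot j \<theta>)) \<cdot>\<^sub>m unit_mat t \<alpha> \<beta>)"
    by (auto simp: trig_monomials_def)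
  \<comment> \<open>This matrix replaces the matrix unit both in the symbol and in every block of
    the matrix.\<close>
  let ?E = "rel_mat u t S * unit_mat t \<alpha> \<beta> * rel_mat t u S'"
  have E: "?E \<in> carrier_mat u u" by (meson mult_carrier_mat rel_mat_carrier unit_mat_carrier)
  have symb: "rel_mat u t S * (F z + a (fst z) \<cdot>\<^sub>m f (snd z)) * rel_mat t u S' =
      ?F z + (a (fst z) * exp (\<i> * of_real (freq_dot j (snd z)))) \<cdot>\<^sub>m ?E" for z
    unfolding f smult_smult_mat[symmetric]
    by (simp add: add_sandwich_mat[OF rel_mat_carrier glt_poly_carrier(1)[OF add(1)] _ rel_mat_carrier]
        smult_sandwich_mat[OF rel_mat_carrier _ rel_mat_carrier] del: index_mult_mat)
  have mtx: "lift_mat (\<nu> n) u t S * (B n + ?ST n) * lift_mat (\<nu> n) t u S' =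
      ?B n + level_mat (\<nu> n) u u (\<lambda>k l. ?st n j k l \<cdot>\<^sub>m ?E)" for n
    unfolding f sampling_toeplitz_monomial
    by (simp add: add_sandwich_mat[OF rel_mat_carrier glt_poly_carrier(2)[OF add(1)] level_mat_carrier rel_mat_carrier]
        lift_rel_sandwich[OF S S'] smult_sandwich_mat[OF rel_mat_carrier _ rel_mat_carrier])
  show ?case
  proof (cases "\<exists>p<u. \<exists>q<u. S p \<alpha> \<and> S' \<beta> q")
    case True
    then obtain p q where pq: "p < u" "q < u" "S p \<alpha>" "S' \<beta> q" by blast
    let ?f = "\<lambda>\<theta>. exp (\<i> * of_real (freq_dot j \<theta>)) \<cdot>\<^sub>m unit_mat u p q"
    have Eu: "?E = unit_mat u p q" by (rule rel_mat_unit_mat(1)[OF S S' ab pq(3,4)])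
    have "?f \<in> trig_monomials u" using pq unfolding trig_monomials_def by blast
    from glt_poly.add[OF add.IH add(2) this] show ?thesis
      unfolding symb mtx Eu sampling_toeplitz_monomial smult_smult_mat .
  next
    \<comment> \<open>The zero function is not a monomial. The term is therefore dropped on both
      sides, and the induction hypothesis remains.\<close>
    case False
    have Eu: "?E = 0\<^sub>m u u" by (rule rel_mat_unit_mat(2)[OF S S' ab False])
    have *: "(\<lambda>z. ?F z + (a (fst z) * exp (\<i> * of_real (freq_dot j (snd z)))) \<cdot>\<^sub>m 0\<^sub>m u u) = ?F"
      by (intro ext) (simp add: right_add_zero_mat[OF mult_carrier_mat[OF mult_carrier_mat[OF
            rel_mat_carrier glt_poly_carrier(1)[OF add(1)]] rel_mat_carrier]])
    have **: "(\<lambda>n. ?B n + level_mat (\<nu> n) u u (\<lambda>k l. ?st n j k l \<cdot>\<^sub>m 0\<^sub>m u u)) = ?B"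
      by (intro ext) (simp add: level_mat_zero right_add_zero_mat[OF mult_carrier_mat[OF mult_carrier_mat[OF
            rel_mat_carrier glt_poly_carrier(2)[OF add(1)]] rel_mat_carrier]])
    show ?thesis unfolding symb mtx Eu * ** by (rule add.IH)
  qed
qed

section \<open>Approximating classes of sequences under sums and sandwiches\<close>

lemma acs_add:
  assumes "acs I d e B A" "acs I d e B' A'"
    and B: "\<And>m n. B m n \<in> carrier_mat (d n) (e n)" "\<And>m n. B' m n \<in> carrier_mat (d n) (e n)"
  shows "acs I d e (\<lambda>m n. B m n + B' m n) (\<lambda>n. A n + A' n)"
proof -
  from assms(1) obtain n0 c \<omega> where l: "c \<longlonglongrightarrow> 0" "\<omega> \<longlonglongrightarrow> 0"
    and 1: "\<forall>m. \<forall>n\<in>I. n \<ge> n0 m \<longrightarrow> (\<exists>R\<in>carrier_mat (d n) (e n). \<exists>Q\<in>carrier_mat (d n) (e n).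
      A n = B m n + R + Q \<and> real (mat_rank R) \<le> c m * real (min (d n) (e n)) \<and> spectral_norm Q \<le> \<omega> m)"
    unfolding acs_def by blast
  from assms(2) obtain n0' c' \<omega>' where l': "c' \<longlonglongrightarrow> 0" "\<omega>' \<longlonglongrightarrow> 0"
    and 2: "\<forall>m. \<forall>n\<in>I. n \<ge> n0' m \<longrightarrow> (\<exists>R\<in>carrier_mat (d n) (e n). \<exists>Q\<in>carrier_mat (d n) (e n).
      A' n = B' m n + R + Q \<and> real (mat_rank R) \<le> c' m * real (min (d n) (e n)) \<and> spectral_norm Q \<le> \<omega>' m)"
    unfolding acs_def by blast
  have lim: "(\<lambda>m. c m + c' m) \<longlonglongrightarrow> 0" "(\<lambda>m. \<omega> m + \<omega>' m) \<longlonglongrightarrow> 0"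
    using tendsto_add[OF l(1) l'(1)] tendsto_add[OF l(2) l'(2)] by simp_all
  have dec: "\<exists>R\<in>carrier_mat (d n) (e n). \<exists>Q\<in>carrier_mat (d n) (e n).
      A n + A' n = B m n + B' m n + R + Q \<and> real (mat_rank R) \<le> (c m + c' m) * real (min (d n) (e n)) \<and>
      spectral_norm Q \<le> \<omega> m + \<omega>' m" if n: "n \<in> I" "n \<ge> max (n0 m) (n0' m)" for m n
  proof -
    from 1[rule_format, OF n(1), of m] n(2) obtain R Q where RQ: "R \<in> carrier_mat (d n) (e n)" "Q \<in> carrier_mat (d n) (e n)"
      "A n = B m n + R + Q" "real (mat_rank R) \<le> c m * real (min (d n) (e n))" "spectral_norm Q \<le> \<omega> m"
      unfolding max.bounded_iff by blast
    from 2[rule_format, OF n(1), of m] n(2) obtain R' Q' where RQ': "R' \<in> carrier_mat (d n) (e n)" "Q' \<in> carrier_mat (d n) (e n)"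
      "A' n = B' m n + R' + Q'" "real (mat_rank R') \<le> c' m * real (min (d n) (e n))" "spectral_norm Q' \<le> \<omega>' m"
      unfolding max.bounded_iff by blast
    show ?thesis
    proof (intro bexI conjI)
      show "A n + A' n = B m n + B' m n + (R + R') + (Q + Q')"
        unfolding RQ(3) RQ'(3) using RQ(1,2) RQ'(1,2) B[of m n] by (intro eq_matI) auto
      have "real (mat_rank (R + R')) \<le> real (mat_rank R) + real (mat_rank R')"
        using rank_add_le[OF RQ(1) RQ'(1)] by linarith
      thus "real (mat_rank (R + R')) \<le> (c m + c' m) * real (min (d n) (e n))"
        using RQ(4) RQ'(4) unfolding distrib_right by linarith
      show "spectral_norm (Q + Q') \<le> \<omega> m + \<omega>' m"
        using spectral_norm_add_le[OF RQ(2) RQ'(2)] RQ(5) RQ'(5) by linarith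
    qed (use RQ RQ' in auto)
  qed
  \<comment> \<open>The threshold is left open and becomes the maximum of the two given ones when
    \<open>dec\<close> is applied.\<close>
  show ?thesis unfolding acs_def
  proof (intro exI conjI allI ballI impI)
    show "(\<lambda>m. c m + c' m) \<longlonglongrightarrow> 0" "(\<lambda>m. \<omega> m + \<omega>' m) \<longlonglongrightarrow> 0" by (rule lim)+
  qed (rule dec)
qed

text \<open>The rank bound refers to order \<open>d n\<close> before the multiplication and to order
  \<open>d' n\<close> after it. A ratio \<open>K\<close> independent of \<open>n\<close> keeps the
  new factor \<open>c m * K\<close> a null sequence that depends on \<open>m\<close> only.\<close>

lemma acs_sandwich:
  assumes "acs I d d B A" and B: "\<And>m n. B m n \<in> carrier_mat (d n) (d n)"
    and P: "\<And>n. P n \<in> carrier_mat (d' n) (d n)" "\<And>n. contraction (P n)"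
    and Q: "\<And>n. Q n \<in> carrier_mat (d n) (d' n)" "\<And>n. contraction (Q n)"
    and K: "\<And>n. real (d n) = K * real (d' n)"
  shows "acs I d' d' (\<lambda>m n. P n * B m n * Q n) (\<lambda>n. P n * A n * Q n)"
proof -
  from assms(1) obtain n0 c \<omega> where l: "c \<longlonglongrightarrow> 0" "\<omega> \<longlonglongrightarrow> 0"
    and 1: "\<forall>m. \<forall>n\<in>I. n \<ge> n0 m \<longrightarrow> (\<exists>R\<in>carrier_mat (d n) (d n). \<exists>T\<in>carrier_mat (d n) (d n).
      A n = B m n + R + T \<and> real (mat_rank R) \<le> c m * real (min (d n) (d n)) \<and> spectral_norm T \<le> \<omega> m)"
    unfolding acs_def by blast
  have lim: "(\<lambda>m. c m * K) \<longlonglongrightarrow> 0" using tendsto_mult_right[OF l(1), of K] by simp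
  have dec: "\<exists>R\<in>carrier_mat (d' n) (d' n). \<exists>T\<in>carrier_mat (d' n) (d' n).
      P n * A n * Q n = P n * B m n * Q n + R + T \<and>
      real (mat_rank R) \<le> c m * K * real (min (d' n) (d' n)) \<and> spectral_norm T \<le> \<omega> m"
    if n: "n \<in> I" "n \<ge> n0 m" for m n
  proof -
    from 1[rule_format, OF n] obtain R T where R: "R \<in> carrier_mat (d n) (d n)" and T: "T \<in> carrier_mat (d n) (d n)" and
      eq: "A n = B m n + R + T" "real (mat_rank R) \<le> c m * real (d n)" "spectral_norm T \<le> \<omega> m"
      unfolding min.idem by blast
    note P1 = P(1)[of n] and Q1 = Q(1)[of n]
    show ?thesis
    proof (intro bexI conjI)
      show "P n * A n * Q n = P n * B m n * Q n + P n * R * Q n + P n * T * Q n"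
        unfolding eq(1) using add_sandwich_mat[OF P1 add_carrier_mat[OF R] T Q1] add_sandwich_mat[OF P1 B R Q1]
        by simp
      have "mat_rank (P n * R * Q n) \<le> mat_rank R"
        using rank_mult_right_le[OF mult_carrier_mat[OF P1 R] Q1] rank_mult_left_le[OF P1 R] by linarith
      thus "real (mat_rank (P n * R * Q n)) \<le> c m * K * real (min (d' n) (d' n))"
        using eq(2) K[of n] by (simp add: mult.assoc)
      show "spectral_norm (P n * T * Q n) \<le> \<omega> m"
        using spectral_norm_contraction_le[OF P1 P(2) T Q1 Q(2)] eq(3) by linarith
    qed (use mult_carrier_mat[OF mult_carrier_mat[OF P1 R] Q1] mult_carrier_mat[OF mult_carrier_mat[OF P1 T] Q1] in auto)
  qed
  show ?thesis unfolding acs_def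
  proof (intro exI conjI allI ballI impI)
    show "(\<lambda>m. c m * K) \<longlonglongrightarrow> 0" "\<omega> \<longlonglongrightarrow> 0" by (rule lim l)+
  qed (rule dec)
qed

lemma acs_cong: "(\<And>n. n \<in> I \<Longrightarrow> A n = A' n) \<Longrightarrow> acs I d e B A \<longleftrightarrow> acs I d e B A'"
  unfolding acs_def by simp

section \<open>Sums and sandwiches of square GLT sequences\<close>

lemma square_GLT_cong:
  assumes "\<And>n. n \<in> I \<Longrightarrow> A n = A' n" "\<And>z. z \<in> symbol_domain \<Longrightarrow> \<kappa> z = \<kappa>' z"
  shows "square_GLT I \<nu> s A \<kappa> \<longleftrightarrow> square_GLT I \<nu> s A' \<kappa>'"
proof -
  have "(AE z in lebesgue_on symbol_domain. \<forall>\<alpha><s. \<forall>\<beta><s. (\<lambda>m. F m z $$ (\<alpha>, \<beta>)) \<longlonglongrightarrow> \<kappa> z $$ (\<alpha>, \<beta>)) \<longleftrightarrow>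
    (AE z in lebesgue_on symbol_domain. \<forall>\<alpha><s. \<forall>\<beta><s. (\<lambda>m. F m z $$ (\<alpha>, \<beta>)) \<longlonglongrightarrow> \<kappa>' z $$ (\<alpha>, \<beta>))" for F :: "nat \<Rightarrow> _ \<Rightarrow> complex mat"
    by (rule AE_cong) (simp add: assms(2))
  thus ?thesis unfolding square_GLT_iff using acs_cong[of I A A', OF assms(1)] by simp
qed

lemma square_GLT_zero:
  "square_GLT I \<nu> s (\<lambda>n. 0\<^sub>m (N_of (\<nu> n) * s) (N_of (\<nu> n) * s)) (\<lambda>z. 0\<^sub>m s s)"
proof -
  have "acs I (\<lambda>n. N_of (\<nu> n) * s) (\<lambda>n. N_of (\<nu> n) * s) (\<lambda>m n. 0\<^sub>m (N_of (\<nu> n) * s) (N_of (\<nu> n) * s))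
      (\<lambda>n. 0\<^sub>m (N_of (\<nu> n) * s) (N_of (\<nu> n) * s))"
    unfolding acs_def
    by (rule exI[of _ "\<lambda>_. 0"], rule exI[of _ "\<lambda>_. 0"], rule exI[of _ "\<lambda>_. 0"])
      (auto simp: rank_zero spectral_norm_zero_le intro!: bexI[of _ "0\<^sub>m _ _"])
  thus ?thesis unfolding square_GLT_iff
    by (intro exI[of _ "\<lambda>m z. 0\<^sub>m s s"] exI[of _ "\<lambda>m n. 0\<^sub>m (N_of (\<nu> n) * s) (N_of (\<nu> n) * s)"])
      (auto intro: glt_poly.zero)
qed

lemma square_GLT_add:
  assumes "square_GLT I \<nu> s A \<kappa>" "square_GLT I \<nu> s A' \<kappa>'"
    and \<kappa>: "\<And>z. z \<in> symbol_domain \<Longrightarrow> \<kappa>' z \<in> carrier_mat s s"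
  shows "square_GLT I \<nu> s (\<lambda>n. A n + A' n) (\<lambda>z. \<kappa> z + \<kappa>' z)"
proof -
  let ?d = "\<lambda>n. N_of (\<nu> n) * s"
  from assms(1) obtain F B where 1: "\<And>m. glt_poly \<nu> s (F m) (B m)"
    "AE z in lebesgue_on symbol_domain. \<forall>\<alpha><s. \<forall>\<beta><s. (\<lambda>m. F m z $$ (\<alpha>, \<beta>)) \<longlonglongrightarrow> \<kappa> z $$ (\<alpha>, \<beta>)"
    "acs I ?d ?d B A" unfolding square_GLT_iff by blast
  from assms(2) obtain G C where 2: "\<And>m. glt_poly \<nu> s (G m) (C m)"
    "AE z in lebesgue_on symbol_domain. \<forall>\<alpha><s. \<forall>\<beta><s. (\<lambda>m. G m z $$ (\<alpha>, \<beta>)) \<longlonglongrightarrow> \<kappa>' z $$ (\<alpha>, \<beta>)"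
    "acs I ?d ?d C A'" unfolding square_GLT_iff by blast
  have "AE z in lebesgue_on symbol_domain. \<forall>\<alpha><s. \<forall>\<beta><s.
      (\<lambda>m. (F m z + G m z) $$ (\<alpha>, \<beta>)) \<longlonglongrightarrow> (\<kappa> z + \<kappa>' z) $$ (\<alpha>, \<beta>)"
    using 1(2) 2(2) AE_space
  proof eventually_elim
    case (elim z)
    hence "\<kappa>' z \<in> carrier_mat s s" using \<kappa> by simp
    thus ?case using elim carrier_matD[OF glt_poly_carrier(1)[OF 2(1)]] by (auto intro!: tendsto_add)
  qed
  moreover have "acs I ?d ?d (\<lambda>m n. B m n + C m n) (\<lambda>n. A n + A' n)"
    by (rule acs_add[OF 1(3) 2(3)]) (rule glt_poly_carrier(2)[OF 1(1)] glt_poly_carrier(2)[OF 2(1)])+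
  moreover have "glt_poly \<nu> s (\<lambda>z. F m z + G m z) (\<lambda>n. B m n + C m n)" for m
    by (rule glt_poly_add[OF 1(1) 2(1)])
  ultimately show ?thesis unfolding square_GLT_iff
    by (intro exI[of _ "\<lambda>m z. F m z + G m z"] exI[of _ "\<lambda>m n. B m n + C m n"] conjI allI)
qed

text \<open>The sum is formed inside the level blocks, which is where
  \<open>extend_mat_block_array\<close> produces it; additivity of \<open>level_mat\<close> reduces
  this to sums of sequences.\<close>

lemma square_GLT_mat_sum:
  assumes "finite S"
    and "\<And>i. i \<in> S \<Longrightarrow> square_GLT I \<nu> s (\<lambda>n. level_mat (\<nu> n) s s (x i n)) (\<kappa> i)"
    and x: "\<And>i n k l. i \<in> S \<Longrightarrow> x i n k l \<in> carrier_mat s s"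
    and \<kappa>: "\<And>i z. i \<in> S \<Longrightarrow> z \<in> symbol_domain \<Longrightarrow> \<kappa> i z \<in> carrier_mat s s"
  shows "square_GLT I \<nu> s (\<lambda>n. level_mat (\<nu> n) s s (\<lambda>k l. mat_sum s s (\<lambda>i. x i n k l) S))
    (\<lambda>z. mat_sum s s (\<lambda>i. \<kappa> i z) S)"
  using assms
proof (induction S rule: finite_induct)
  case empty
  show ?case by (simp add: level_mat_zero square_GLT_zero)
next
  case (insert i S)
  have "square_GLT I \<nu> s (\<lambda>n. level_mat (\<nu> n) s s (\<lambda>k l. mat_sum s s (\<lambda>i. x i n k l) S) + level_mat (\<nu> n) s s (x i n))
    (\<lambda>z. mat_sum s s (\<lambda>i. \<kappa> i z) S + \<kappa> i z)"
    using insert.prems by (intro square_GLT_add insert.IH) auto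
  also have "(\<lambda>n. level_mat (\<nu> n) s s (\<lambda>k l. mat_sum s s (\<lambda>i. x i n k l) S) + level_mat (\<nu> n) s s (x i n)) =
      (\<lambda>n. level_mat (\<nu> n) s s (\<lambda>k l. mat_sum s s (\<lambda>i. x i n k l) (insert i S)))"
    using insert by (simp add: level_mat_add mat_sum_insert)
  finally show ?case
    by (rule square_GLT_cong[THEN iffD1, rotated 2]) (use insert in \<open>auto simp: mat_sum_insert\<close>)
qed

text \<open>Entries of the multiplied symbols are fixed finite linear combinations of the original
  entries, so convergence almost everywhere carries over. Positivity of \<open>u\<close> makes t / u
  a valid ratio of the matrix orders.\<close>

lemma square_GLT_sandwich:
  assumes "square_GLT I \<nu> t A \<kappa>" and S: "partial_inj S" and S': "partial_inj S'" and u: "0 < u"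
    and \<kappa>: "\<And>z. z \<in> symbol_domain \<Longrightarrow> \<kappa> z \<in> carrier_mat t t"
  shows "square_GLT I \<nu> u (\<lambda>n. lift_mat (\<nu> n) u t S * A n * lift_mat (\<nu> n) t u S')
    (\<lambda>z. rel_mat u t S * \<kappa> z * rel_mat t u S')"
proof -
  let ?d = "\<lambda>n. N_of (\<nu> n) * t" and ?d' = "\<lambda>n. N_of (\<nu> n) * u"
  from assms(1) obtain F B where 1: "\<And>m. glt_poly \<nu> t (F m) (B m)"
    "AE z in lebesgue_on symbol_domain. \<forall>\<alpha><t. \<forall>\<beta><t. (\<lambda>m. F m z $$ (\<alpha>, \<beta>)) \<longlonglongrightarrow> \<kappa> z $$ (\<alpha>, \<beta>)"
    "acs I ?d ?d B A" unfolding square_GLT_iff by blast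
  note Fc = glt_poly_carrier(1)[OF 1(1)]
  have "AE z in lebesgue_on symbol_domain. \<forall>\<alpha><u. \<forall>\<beta><u.
      (\<lambda>m. (rel_mat u t S * F m z * rel_mat t u S') $$ (\<alpha>, \<beta>)) \<longlonglongrightarrow> (rel_mat u t S * \<kappa> z * rel_mat t u S') $$ (\<alpha>, \<beta>)"
    using 1(2) AE_space
  proof eventually_elim
    case (elim z)
    hence \<kappa>z: "\<kappa> z \<in> carrier_mat t t" using \<kappa> by simp
    show ?case
    proof (intro allI impI)
      fix \<alpha> \<beta> assume ab: "\<alpha> < u" "\<beta> < u"
      show "(\<lambda>m. (rel_mat u t S * F m z * rel_mat t u S') $$ (\<alpha>, \<beta>)) \<longlonglongrightarrow> (rel_mat u t S * \<kappa> z * rel_mat t u S') $$ (\<alpha>, \<beta>)"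
        unfolding index_mult3[OF rel_mat_carrier Fc rel_mat_carrier ab] index_mult3[OF rel_mat_carrier \<kappa>z rel_mat_carrier ab]
        using elim(1) by (intro tendsto_intros) auto
    qed
  qed
  moreover have "acs I ?d' ?d' (\<lambda>m n. lift_mat (\<nu> n) u t S * B m n * lift_mat (\<nu> n) t u S')
      (\<lambda>n. lift_mat (\<nu> n) u t S * A n * lift_mat (\<nu> n) t u S')"
  proof (rule acs_sandwich[OF 1(3), where K = "real t / real u"])
    show "B m n \<in> carrier_mat (?d n) (?d n)" for m n by (rule glt_poly_carrier(2)[OF 1(1)])
    show "real (?d n) = real t / real u * real (?d' n)" for n using u by simp
  qed (simp_all add: contraction_rel_mat partial_inj_lift_rel S S')
  moreover have "glt_poly \<nu> u (\<lambda>z. rel_mat u t S * F m z * rel_mat t u S')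
      (\<lambda>n. lift_mat (\<nu> n) u t S * B m n * lift_mat (\<nu> n) t u S')" for m
    by (rule glt_poly_sandwich[OF 1(1) S S'])
  ultimately show ?thesis unfolding square_GLT_iff
    by (intro exI[of _ "\<lambda>m z. rel_mat u t S * F m z * rel_mat t u S'"]
        exI[of _ "\<lambda>m n. lift_mat (\<nu> n) u t S * B m n * lift_mat (\<nu> n) t u S'"] conjI allI)
qed

lemma square_GLT_level_mat_sandwich:
  assumes "square_GLT I \<nu> t (\<lambda>n. level_mat (\<nu> n) t t (x n)) \<kappa>" and "partial_inj S" "partial_inj S'" "0 < u"
    and x: "\<And>n k l. x n k l \<in> carrier_mat t t"
    and "\<And>z. z \<in> symbol_domain \<Longrightarrow> \<kappa> z \<in> carrier_mat t t"
  shows "square_GLT I \<nu> u (\<lambda>n. level_mat (\<nu> n) u u (\<lambda>k l. rel_mat u t S * x n k l * rel_mat t u S'))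
    (\<lambda>z. rel_mat u t S * \<kappa> z * rel_mat t u S')"
  using square_GLT_sandwich[OF assms(1-4,6)] by (simp only: lift_rel_sandwich[OF assms(2,3) x])

section \<open>Block matrices\<close>

lemma index_kronecker:
  "p < dim_row X * dim_row Y \<Longrightarrow> q < dim_col X * dim_col Y \<Longrightarrow> (X \<otimes>\<^sub>K Y) $$ (p, q) =
    X $$ (p div dim_row Y, q div dim_col Y) * Y $$ (p mod dim_row Y, q mod dim_col Y)"
  and dim_row_kronecker [simp]: "dim_row (X \<otimes>\<^sub>K Y) = dim_row X * dim_row Y"
  and dim_col_kronecker [simp]: "dim_col (X \<otimes>\<^sub>K Y) = dim_col X * dim_col Y"
  by (simp_all add: kronecker_def)

lemma dim_row_basis_column [simp]: "dim_row (basis_column k i) = k"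
  and dim_col_basis_column [simp]: "dim_col (basis_column k i) = 1"
  and index_basis_column: "p < k \<Longrightarrow> i < k \<Longrightarrow> basis_column k i $$ (p, 0) = of_bool (p = i)"
  by (simp_all add: basis_column_def mat_of_cols_index unit_vec_def)

lemma perm_mat_carrier [simp]: "perm_mat k1 k2 \<in> carrier_mat (k1 * k2) (k1 * k2)"
  and dim_row_perm_mat [simp]: "dim_row (perm_mat k1 k2) = k1 * k2"
  and dim_col_perm_mat [simp]: "dim_col (perm_mat k1 k2) = k1 * k2"
  by (simp_all add: perm_mat_def mat_sum_def)

text \<open>The factor \<open>basis_column k2 i\<close> restricts summand \<open>i\<close> to rows
  with \<open>p div k1 = i\<close>. There the identity matches \<open>p mod k1\<close> with
  \<open>q div k2\<close>, and the transposed basis column matches \<open>i\<close> with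
  \<open>q mod k2\<close>. So the two digits of a position are swapped.\<close>

lemma index_perm_mat:
  assumes p: "p < k1 * k2" and q: "q < k1 * k2"
  shows "perm_mat k1 k2 $$ (p, q) = of_bool (q = (p mod k1) * k2 + p div k1)"
proof -
  have pk: "p div k1 < k2" "p mod k1 < k1" and qk: "q div k2 < k1" "q mod k2 < k2"
    using less_mult_imp_div_less[of p k2 k1] mod_less_of_less_mult[of p k2 k1]
      less_mult_imp_div_less[OF q] mod_less_of_less_mult[OF q] p by (simp_all add: mult.commute)
  have qeq: "q = (p mod k1) * k2 + p div k1 \<longleftrightarrow> p div k1 = q mod k2 \<and> p mod k1 = q div k2"
  proof
    show "p div k1 = q mod k2 \<and> p mod k1 = q div k2" if "q = (p mod k1) * k2 + p div k1"
      using that pk by simp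
    show "q = (p mod k1) * k2 + p div k1" if "p div k1 = q mod k2 \<and> p mod k1 = q div k2"
      using that by simp
  qed
  have "(basis_column k2 i \<otimes>\<^sub>K 1\<^sub>m k1 \<otimes>\<^sub>K transpose_mat (basis_column k2 i)) $$ (p, q) =
      (if i = p div k1 then of_bool (p mod k1 = q div k2) * of_bool (q mod k2 = i) else 0)" if "i < k2" for i
    using that p q pk qk by (simp add: index_kronecker index_basis_column mult.commute)
  hence "perm_mat k1 k2 $$ (p, q) = (\<Sum>i<k2. if i = p div k1 then of_bool (p mod k1 = q div k2) * of_bool (q mod k2 = i) else 0)"
    using p q unfolding perm_mat_def mat_sum_def by simp
  also have "\<dots> = of_bool (q = (p mod k1) * k2 + p div k1)"
    using pk qeq by auto
  finally show ?thesis .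
qed

text \<open>Row \<open>a * r + b\<close> of the level-wise block matrix comes from row \<open>a\<close>, \<open>b - block_start rr i\<close>
  of the \<open>i\<close>-th block row, where \<open>b\<close> belongs to block \<open>i\<close>.\<close>

definition block_row_pos :: "(nat \<Rightarrow> nat) \<Rightarrow> nat \<Rightarrow> nat \<Rightarrow> nat \<Rightarrow> nat" where
  "block_row_pos rr r N p = (let b = p mod r; i = block_no rr b in
     N * block_start rr i + (p div r * rr i + (b - block_start rr i)))"

lemma block_start_mult: "block_start (\<lambda>i. N * rr i) i = N * block_start rr i"
  by (simp add: block_start_def sum_distrib_left)

text \<open>Follow row \<open>p = a * r + b\<close>. The first factor leads to position
  \<open>b * N + a\<close>. With \<open>b = block_start rr i + b'\<close>, this lies in diagonal
  block \<open>i\<close> at offset \<open>b' * N + a\<close>, which the transposed permutation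
  matrix turns into \<open>a * rr i + b'\<close>.\<close>

lemma index_perm_mat_mult_diag:
  assumes r: "r = (\<Sum>i<\<rho>. rr i)" and p: "p < N * r" and q: "q < N * r"
  shows "(perm_mat r N * diag_block_mat (map (\<lambda>i. transpose_mat (perm_mat (rr i) N)) [0..<\<rho>])) $$ (p, q) =
    of_bool (q = block_row_pos rr r N p)" (is "(?P * ?D) $$ _ = _")
proof -
  let ?rr = "\<lambda>i. N * rr i"
  have D: "?D = block_array \<rho> \<rho> ?rr ?rr (\<lambda>i j. if i = j then transpose_mat (perm_mat (rr i) N) else 0\<^sub>m (?rr i) (?rr j))"
    by (rule diag_block_mat_eq_block_array) (simp add: carrier_matI mult.commute)
  have sum: "(\<Sum>i<\<rho>. ?rr i) = N * r" by (simp add: r sum_distrib_left)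
  have Dc: "?D \<in> carrier_mat (N * r) (N * r)" unfolding D using block_array_carrier[of \<rho> \<rho> ?rr ?rr] by (simp add: sum)
  define a b where "a = p div r" and "b = p mod r"
  have ab: "a < N" "b < r" using less_mult_imp_div_less[OF p] mod_less_of_less_mult[OF p] by (simp_all add: a_def b_def)
  define i where "i = block_no rr b"
  define b' where "b' = b - block_start rr i"
  have i: "i < \<rho>" "b' < rr i" "b = block_start rr i + b'"
    using block_no_sum[of b rr \<rho>] ab r by (auto simp: i_def b'_def)
  define j where "j = block_no ?rr q"
  define c where "c = q - block_start ?rr j"
  have j: "j < \<rho>" "c < N * rr j" "q = block_start ?rr j + c"
    using block_no_sum[of q ?rr \<rho>] q sum by (auto simp: j_def c_def)
  have lt: "b' * N + a < N * rr i" using mult_add_less[OF i(2) ab(1)] by (simp add: mult.commute)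
  have pos: "block_row_pos rr r N p = block_start ?rr i + (a * rr i + b')"
    by (simp add: block_row_pos_def Let_def a_def b_def i_def b'_def block_start_mult)
  have lt': "a * rr i + b' < N * rr i" using mult_add_less[OF ab(1) i(2)] .
  have src: "b * N + a < N * r" using mult_add_less[OF ab(2,1)] by (simp add: mult.commute)
  have "(?P * ?D) $$ (p, q) = (\<Sum>m<N * r. ?P $$ (p, m) * ?D $$ (m, q))"
    using p q Dc by (simp add: scalar_prod_def lessThan_atLeast0 mult.commute)
  also have "\<dots> = (\<Sum>m<N * r. if m = b * N + a then ?D $$ (m, q) else 0)"
    using p by (intro sum.cong refl) (auto simp: index_perm_mat mult.commute[of r N] a_def b_def)
  also have "\<dots> = ?D $$ (b * N + a, q)" using src by simp
  also have "b * N + a = block_start ?rr i + (b' * N + a)"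
    unfolding i(3) by (simp add: block_start_mult algebra_simps)
  also have "?D $$ (block_start ?rr i + (b' * N + a), q) =
      (if i = j then transpose_mat (perm_mat (rr i) N) else 0\<^sub>m (?rr i) (?rr j)) $$ (b' * N + a, c)"
    unfolding D j(3) by (rule index_block_array) (use i j lt in auto)
  also have "\<dots> = of_bool (i = j \<and> b' * N + a = (c mod rr j) * N + c div rr j)"
    using lt j by (auto simp: index_perm_mat mult.commute[of _ N])
  also have "i = j \<and> b' * N + a = (c mod rr j) * N + c div rr j \<longleftrightarrow> q = block_row_pos rr r N p"
  proof
    assume *: "i = j \<and> b' * N + a = (c mod rr j) * N + c div rr j"
    \<comment> \<open>Both \<open>a\<close> and \<open>c div rr j\<close> are remainders modulo
      \<open>N\<close>, so the equation splits into equal quotients and equal remainders.\<close>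
    have "c div rr j < N" using less_mult_imp_div_less[OF j(2)] .
    hence "b' = c mod rr j \<and> a = c div rr j" using * ab(1)
      by (metis add.commute add.right_neutral div_less div_mult_self1 mod_less mod_mult_self1 nat_neq_iff not_less0)
    thus "q = block_row_pos rr r N p" unfolding pos using * j(3) by simp
  next
    assume *: "q = block_row_pos rr r N p"
    have "j = i" unfolding j_def * pos using lt' by (rule block_no_add)
    moreover have "c = a * rr i + b'" using * j(3) \<open>j = i\<close> by (simp add: pos)
    ultimately show "i = j \<and> b' * N + a = (c mod rr j) * N + c div rr j" using i(2) by simp
  qed
  finally show ?thesis .
qed

text \<open>Each outer factor selects a single position by \<open>index_perm_mat_mult_diag\<close>,
  so the double sum reduces to one entry of the block array. Both sides are then the same entry of
  one matrix \<open>X i j\<close>.\<close>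

lemma permuted_block_array:
  fixes n :: "'d::{finite,linorder} \<Rightarrow> nat"
  assumes r: "r = (\<Sum>i<\<rho>. rr i)" and s: "s = (\<Sum>j<\<sigma>. ss j)"
  shows "(perm_mat r (N_of n) * diag_block_mat (map (\<lambda>i. transpose_mat (perm_mat (rr i) (N_of n))) [0..<\<rho>]))
      * block_array \<rho> \<sigma> (\<lambda>i. N_of n * rr i) (\<lambda>j. N_of n * ss j) X
      * transpose_mat (perm_mat s (N_of n) * diag_block_mat (map (\<lambda>j. transpose_mat (perm_mat (ss j) (N_of n))) [0..<\<sigma>]))
    = level_mat n r s (\<lambda>k l. block_array \<rho> \<sigma> rr ss (\<lambda>i j. level_block n (rr i) (ss j) (X i j) k l))"
    (is "?P * ?B * transpose_mat ?Q = ?A")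
proof (rule eq_matI)
  let ?N = "N_of n"
  have dims: "dim_row (diag_block_mat (map (\<lambda>i. transpose_mat (perm_mat (rr i) ?N)) [0..<\<rho>])) = ?N * (\<Sum>i<\<rho>. rr i)"
    "dim_col (diag_block_mat (map (\<lambda>i. transpose_mat (perm_mat (rr i) ?N)) [0..<\<rho>])) = ?N * (\<Sum>i<\<rho>. rr i)" for rr \<rho>
    by (simp_all add: dim_diag_block_mat o_def interv_sum_list_conv_sum_set_nat lessThan_atLeast0
        sum_distrib_left mult.commute)
  have P: "?P \<in> carrier_mat (?N * r) (?N * r)" and Q: "?Q \<in> carrier_mat (?N * s) (?N * s)"
    by (auto simp: dims r s mult.commute intro!: carrier_matI)
  have B: "?B \<in> carrier_mat (?N * r) (?N * s)"
    using block_array_carrier[of \<rho> \<sigma> "\<lambda>i. ?N * rr i" "\<lambda>j. ?N * ss j" X] by (simp add: r s sum_distrib_left)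
  have QT: "transpose_mat ?Q \<in> carrier_mat (?N * s) (?N * s)" using Q by (simp only: transpose_carrier_mat)
  show "dim_row (?P * ?B * transpose_mat ?Q) = dim_row ?A" "dim_col (?P * ?B * transpose_mat ?Q) = dim_col ?A"
    using P B QT carrier_matD by (auto simp: mult.commute)
  fix p q assume "p < dim_row ?A" "q < dim_col ?A"
  hence p: "p < ?N * r" and q: "q < ?N * s" by auto
  \<comment> \<open>Stated for arbitrary block sizes, since it is applied once to the rows and once
    to the columns.\<close>
  have pos: "\<exists>i<\<rho>. \<exists>\<alpha><rr i. p mod r = block_start rr i + \<alpha> \<and>
      block_row_pos rr r ?N p = block_start (\<lambda>i. ?N * rr i) i + (p div r * rr i + \<alpha>) \<and>
      p div r * rr i + \<alpha> < ?N * rr i \<and> block_row_pos rr r ?N p < ?N * r"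
    if r: "r = (\<Sum>i<\<rho>. rr i)" and p: "p < ?N * r" for r \<rho> rr p
  proof (intro exI conjI)
    let ?i = "block_no rr (p mod r)" and ?\<alpha> = "p mod r - block_start rr (block_no rr (p mod r))"
    have i: "?i < \<rho>" "?\<alpha> < rr ?i" "block_start rr ?i \<le> p mod r"
      using block_no_sum[of "p mod r" rr \<rho>] mod_less_of_less_mult[OF p] r by auto
    show "?i < \<rho>" "?\<alpha> < rr ?i" "p mod r = block_start rr ?i + ?\<alpha>" using i by auto
    show eq: "block_row_pos rr r ?N p = block_start (\<lambda>i. ?N * rr i) ?i + (p div r * rr ?i + ?\<alpha>)"
      by (simp add: block_row_pos_def Let_def block_start_mult)
    show lt: "p div r * rr ?i + ?\<alpha> < ?N * rr ?i"
      using mult_add_less[OF less_mult_imp_div_less[OF p] i(2)] .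
    show "block_row_pos rr r ?N p < ?N * r"
      unfolding eq using block_start_add_less[of ?i \<rho> "p div r * rr ?i + ?\<alpha>" "\<lambda>i. ?N * rr i"] lt i
      by (simp add: r sum_distrib_left)
  qed
  from pos[OF r p] obtain i \<alpha> where i: "i < \<rho>" "\<alpha> < rr i" "p mod r = block_start rr i + \<alpha>"
    "block_row_pos rr r ?N p = block_start (\<lambda>i. ?N * rr i) i + (p div r * rr i + \<alpha>)"
    "p div r * rr i + \<alpha> < ?N * rr i" "block_row_pos rr r ?N p < ?N * r" by blast
  from pos[OF s q] obtain j \<beta> where j: "j < \<sigma>" "\<beta> < ss j" "q mod s = block_start ss j + \<beta>"
    "block_row_pos ss s ?N q = block_start (\<lambda>j. ?N * ss j) j + (q div s * ss j + \<beta>)"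
    "q div s * ss j + \<beta> < ?N * ss j" "block_row_pos ss s ?N q < ?N * s" by blast
  have "(?P * ?B * transpose_mat ?Q) $$ (p, q) =
      (\<Sum>k<?N * r. \<Sum>l<?N * s. ?P $$ (p, k) * ?B $$ (k, l) * transpose_mat ?Q $$ (l, q))"
    by (rule index_mult3[OF P B QT p q])
  also have "\<dots> = (\<Sum>k<?N * r. \<Sum>l<?N * s. if k = block_row_pos rr r ?N p then if l = block_row_pos ss s ?N q
      then ?B $$ (k, l) else 0 else 0)"
  proof (intro sum.cong refl)
    fix k l assume kl: "k \<in> {..<?N * r}" "l \<in> {..<?N * s}"
    have "transpose_mat ?Q $$ (l, q) = ?Q $$ (q, l)"
      by (rule index_transpose_mat(1)) (use kl q in \<open>simp_all only: carrier_matD[OF Q] lessThan_iff\<close>)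
    thus "?P $$ (p, k) * ?B $$ (k, l) * transpose_mat ?Q $$ (l, q) =
      (if k = block_row_pos rr r ?N p then if l = block_row_pos ss s ?N q then ?B $$ (k, l) else 0 else 0)"
      using kl index_perm_mat_mult_diag[OF r p, of k] index_perm_mat_mult_diag[OF s q, of l]
      by (simp del: index_mult_mat)
  qed
  also have "\<dots> = (\<Sum>k<?N * r. if k = block_row_pos rr r ?N p then \<Sum>l<?N * s. if l = block_row_pos ss s ?N q
      then ?B $$ (k, l) else 0 else 0)"
    by (intro sum.cong refl) simp
  also have "\<dots> = ?B $$ (block_row_pos rr r ?N p, block_row_pos ss s ?N q)" using i j by simp
  also have "\<dots> = X i j $$ (p div r * rr i + \<alpha>, q div s * ss j + \<beta>)"
    unfolding i(4) j(4) by (rule index_block_array) (fact i(1) j(1) i(5) j(5))+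
  also have "\<dots> = ?A $$ (p, q)"
    using p q i j by (simp add: index_level_mat index_block_array level_block_def
        lex_pos_multi_index[OF less_mult_imp_div_less])
  finally show "(?P * ?B * transpose_mat ?Q) $$ (p, q) = ?A $$ (p, q)" .
qed

text \<open>From the whole to a block, one padded size of the whole suffices, since the sandwich
  leads to every size \<open>u\<close> of the block. Conversely, the blocks are available at each
  padded size \<open>t\<close>, and their placement into the array keeps that size.\<close>

lemma GLT_block_array_iff:
  fixes \<nu> :: "nat \<Rightarrow> 'd::{finite,linorder} \<Rightarrow> nat"
  assumes rr: "\<And>i. i < \<rho> \<Longrightarrow> 0 < rr i" and ne: "0 < \<rho>"
    and \<kappa>ij: "\<And>i j z. i < \<rho> \<Longrightarrow> j < \<sigma> \<Longrightarrow> z \<in> symbol_domain \<Longrightarrow> \<kappa>ij i j z \<in> carrier_mat (rr i) (ss j)"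
    and r: "r = (\<Sum>i<\<rho>. rr i)" and s: "s = (\<Sum>j<\<sigma>. ss j)"
    and A: "\<And>n. n \<in> I \<Longrightarrow> A n = level_mat (\<nu> n) r s
      (\<lambda>k l. block_array \<rho> \<sigma> rr ss (\<lambda>i j. level_block (\<nu> n) (rr i) (ss j) (Aij n i j) k l))"
    and \<kappa>: "\<And>z. z \<in> symbol_domain \<Longrightarrow> \<kappa> z = block_array \<rho> \<sigma> rr ss (\<lambda>i j. \<kappa>ij i j z)"
  shows "GLT I \<nu> r s A \<kappa> \<longleftrightarrow> (\<forall>i<\<rho>. \<forall>j<\<sigma>. GLT I \<nu> (rr i) (ss j) (\<lambda>n. Aij n i j) (\<kappa>ij i j))"
proof -
  define blk where "blk n k l i j = level_block (\<nu> n) (rr i) (ss j) (Aij n i j) k l" for n k l i j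
  define ext where "ext t n k l = extend_mat r s t (block_array \<rho> \<sigma> rr ss (blk n k l))" for t n k l
  define \<kappa>ext where "\<kappa>ext t z = extend_mat r s t (block_array \<rho> \<sigma> rr ss (\<lambda>i j. \<kappa>ij i j z))" for t z
  have blk: "blk n k l i j \<in> carrier_mat (rr i) (ss j)" for n k l i j
    by (simp add: blk_def level_block_def)
  have ba: "block_array \<rho> \<sigma> rr ss X \<in> carrier_mat r s" for X unfolding r s by simp
  have extc: "ext t n k l \<in> carrier_mat t t" and \<kappa>extc: "\<kappa>ext t z \<in> carrier_mat t t"
    if "max r s \<le> t" for t n k l z
    unfolding ext_def \<kappa>ext_def using that by (auto intro!: extend_mat_carrier[OF ba])
  \<comment> \<open>The extension of \<open>A n\<close> is a level matrix whose blocks are padded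
    block arrays, so the identities for extraction and assembly apply block by block.\<close>
  have whole: "square_GLT I \<nu> t (\<lambda>n. extend_level_mat (\<nu> n) r s t (A n)) (\<lambda>z. extend_mat r s t (\<kappa> z)) \<longleftrightarrow>
      square_GLT I \<nu> t (\<lambda>n. level_mat (\<nu> n) t t (ext t n)) (\<kappa>ext t)" for t
  proof (rule square_GLT_cong)
    show "extend_level_mat (\<nu> n) r s t (A n) = level_mat (\<nu> n) t t (ext t n)" if "n \<in> I" for n
      unfolding extend_level_mat_def A[OF that] ext_def blk_def
      by (rule level_mat_cong) (simp add: level_block_level_mat ba)
    show "extend_mat r s t (\<kappa> z) = \<kappa>ext t z" if "z \<in> symbol_domain" for z
      by (simp add: \<kappa>ext_def \<kappa>[OF that])
  qed
  have le: "rr i \<le> r" "ss j \<le> s" if "i < \<rho>" "j < \<sigma>" for i j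
    using that member_le_sum[of i "{..<\<rho>}" rr] member_le_sum[of j "{..<\<sigma>}" ss] by (auto simp: r s)
  have part: "extend_level_mat (\<nu> n) (rr i) (ss j) u (Aij n i j) =
      level_mat (\<nu> n) u u (\<lambda>k l. extend_mat (rr i) (ss j) u (blk n k l i j))" for n i j u
    by (simp add: extend_level_mat_def blk_def)
  show ?thesis
  proof (intro iffI allI impI)
    fix i j assume GLT: "GLT I \<nu> r s A \<kappa>" and i: "i < \<rho>" and j: "j < \<sigma>"
    let ?t = "max r s"
    from GLT have t: "square_GLT I \<nu> ?t (\<lambda>n. level_mat (\<nu> n) ?t ?t (ext ?t n)) (\<kappa>ext ?t)"
      unfolding GLT_def whole by simp
    show "GLT I \<nu> (rr i) (ss j) (\<lambda>n. Aij n i j) (\<kappa>ij i j)"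
      unfolding GLT_def
    proof (intro allI impI)
      fix u assume "max (rr i) (ss j) \<le> u"
      hence u: "rr i \<le> u" "ss j \<le> u" by auto
      have u0: "0 < u" using rr[OF i] u by simp
      let ?P = "rel_mat u ?t (\<lambda>\<alpha> p. block_rel rr i p \<alpha>)" and ?Q = "rel_mat ?t u (block_rel ss j)"
      have tb: "(\<Sum>i<\<rho>. rr i) \<le> ?t" "(\<Sum>j<\<sigma>. ss j) \<le> ?t" by (simp_all add: r s)
      have mtx: "?P * ext ?t n k l * ?Q = extend_mat (rr i) (ss j) u (blk n k l i j)" for n k l
        unfolding ext_def using extend_mat_block[where X = "blk n k l", OF i j blk tb u] by (simp add: r s)
      have "square_GLT I \<nu> u (\<lambda>n. level_mat (\<nu> n) u u (\<lambda>k l. ?P * ext ?t n k l * ?Q)) (\<lambda>z. ?P * \<kappa>ext ?t z * ?Q)"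
        by (rule square_GLT_level_mat_sandwich[OF t partial_inj_conversep[OF partial_inj_block_rel]
              partial_inj_block_rel u0]) (simp_all add: extc \<kappa>extc)
      thus "square_GLT I \<nu> u (\<lambda>n. extend_level_mat (\<nu> n) (rr i) (ss j) u (Aij n i j))
          (\<lambda>z. extend_mat (rr i) (ss j) u (\<kappa>ij i j z))"
        unfolding mtx part
      \<comment> \<open>The size of the symbol is known on \<open>symbol_domain\<close> only, so the
        symbols are exchanged by congruence on that set rather than by rewriting.\<close>
      proof (rule square_GLT_cong[THEN iffD1, rotated 2])
        show "?P * \<kappa>ext ?t z * ?Q = extend_mat (rr i) (ss j) u (\<kappa>ij i j z)" if "z \<in> symbol_domain" for z
          unfolding \<kappa>ext_def using extend_mat_block[where X = "\<lambda>i j. \<kappa>ij i j z", OF i j \<kappa>ij[OF i j that] tb u]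
          by (simp add: r s)
      qed simp
    qed
  next
    assume GLT: "\<forall>i<\<rho>. \<forall>j<\<sigma>. GLT I \<nu> (rr i) (ss j) (\<lambda>n. Aij n i j) (\<kappa>ij i j)"
    show "GLT I \<nu> r s A \<kappa>" unfolding GLT_def
    proof (intro allI impI)
      fix t assume rst: "max r s \<le> t"
      hence tb: "(\<Sum>i<\<rho>. rr i) \<le> t" "(\<Sum>j<\<sigma>. ss j) \<le> t" by (simp_all add: r s)
      \<comment> \<open>Block row 0 exists and has positive size. Positivity of the target size is
        what the rank factor in \<open>square_GLT_sandwich\<close> requires.\<close>
      have t0: "0 < t" using rr[OF ne] tb(1) member_le_sum[of 0 "{..<\<rho>}" rr] ne by auto
      let ?S = "{..<\<rho>} \<times> {..<\<sigma>}"
      \<comment> \<open>The sandwich moves the padded block from the upper left corner to its place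
        in the array.\<close>
      define sw where "sw i j x = rel_mat t t (block_rel rr i) * extend_mat (rr i) (ss j) t x *
        rel_mat t t (\<lambda>\<beta> q. block_rel ss j q \<beta>)" for i j x
      have swc: "sw i j x \<in> carrier_mat t t" for i j x
        unfolding sw_def by (rule carrier_matI) simp_all
      have "square_GLT I \<nu> t (\<lambda>n. level_mat (\<nu> n) t t (\<lambda>k l. mat_sum t t (\<lambda>(i, j). sw i j (blk n k l i j)) ?S))
          (\<lambda>z. mat_sum t t (\<lambda>(i, j). sw i j (\<kappa>ij i j z)) ?S)"
      proof (rule square_GLT_mat_sum[where x = "\<lambda>ij n k l. case ij of (i, j) \<Rightarrow> sw i j (blk n k l i j)"
            and \<kappa> = "\<lambda>ij z. case ij of (i, j) \<Rightarrow> sw i j (\<kappa>ij i j z)"])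
        fix ij assume "ij \<in> ?S"
        then obtain i j where ij: "ij = (i, j)" and i: "i < \<rho>" and j: "j < \<sigma>" by auto
        have u: "rr i \<le> t" "ss j \<le> t" using le[OF i j] rst by auto
        have "square_GLT I \<nu> t (\<lambda>n. level_mat (\<nu> n) t t (\<lambda>k l. extend_mat (rr i) (ss j) t (blk n k l i j)))
            (\<lambda>z. extend_mat (rr i) (ss j) t (\<kappa>ij i j z))"
          using GLT i j u unfolding GLT_def part by simp
        from square_GLT_level_mat_sandwich[OF this partial_inj_block_rel[of rr i]
            partial_inj_conversep[OF partial_inj_block_rel[of ss j]] t0]
        have "square_GLT I \<nu> t (\<lambda>n. level_mat (\<nu> n) t t (\<lambda>k l. sw i j (blk n k l i j)))
            (\<lambda>z. sw i j (\<kappa>ij i j z))"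
          unfolding sw_def by (simp add: extend_mat_carrier[OF blk u] extend_mat_carrier[OF \<kappa>ij[OF i j] u])
        thus "square_GLT I \<nu> t (\<lambda>n. level_mat (\<nu> n) t t
            (\<lambda>k l. case ij of (i, j) \<Rightarrow> sw i j (blk n k l i j))) (\<lambda>z. case ij of (i, j) \<Rightarrow> sw i j (\<kappa>ij i j z))"
          by (simp add: ij)
      qed (auto simp: swc)
      hence "square_GLT I \<nu> t (\<lambda>n. level_mat (\<nu> n) t t (ext t n)) (\<kappa>ext t)"
      proof (rule square_GLT_cong[THEN iffD1, rotated 2])
        show "level_mat (\<nu> n) t t (\<lambda>k l. mat_sum t t (\<lambda>(i, j). sw i j (blk n k l i j)) ?S) = level_mat (\<nu> n) t t (ext t n)"
          for n unfolding ext_def sw_def r s by (simp add: extend_mat_block_array[where X = "blk _ _ _", OF blk tb])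
        show "mat_sum t t (\<lambda>(i, j). sw i j (\<kappa>ij i j z)) ?S = \<kappa>ext t z" if "z \<in> symbol_domain" for z
          unfolding \<kappa>ext_def sw_def r s 
          by (rule extend_mat_block_array[where X = "\<lambda>i j. \<kappa>ij i j z", OF \<kappa>ij[OF _ _ that] tb, symmetric])
      qed
      thus "square_GLT I \<nu> t (\<lambda>n. extend_level_mat (\<nu> n) r s t (A n)) (\<lambda>z. extend_mat r s t (\<kappa> z))"
        unfolding whole .
    qed
  qed
qed

theorem theorem4p12:
  fixes I :: "nat set"
    and \<nu> :: "nat \<Rightarrow> 'd::{finite,linorder} \<Rightarrow> nat"
    and \<rho> \<sigma> :: nat
    and rr ss :: "nat \<Rightarrow> nat"
    and r s :: nat
    and Aij :: "nat \<Rightarrow> nat \<Rightarrow> nat \<Rightarrow> complex mat"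
    and A B :: "nat \<Rightarrow> complex mat"
    and \<kappa>ij :: "nat \<Rightarrow> nat \<Rightarrow> (real ^ 'd::{finite,linorder}) \<times> (real ^ 'd::{finite,linorder}) \<Rightarrow> complex mat"
    and \<kappa> :: "(real ^ 'd::{finite,linorder}) \<times> (real ^ 'd::{finite,linorder}) \<Rightarrow> complex mat"
  assumes "\<rho> \<ge> 1" and "\<sigma> \<ge> 1"
    and "\<And>i. i < \<rho> \<Longrightarrow> rr i \<ge> 1" and "\<And>j. j < \<sigma> \<Longrightarrow> ss j \<ge> 1"
    and "\<And>i j. i < \<rho> \<Longrightarrow> j < \<sigma> \<Longrightarrow> block_matrix_sequence I \<nu> (rr i) (ss j) (\<lambda>n. Aij n i j)"
    and "\<And>i j. i < \<rho> \<Longrightarrow> j < \<sigma> \<Longrightarrow> measurable_symbol (rr i) (ss j) (\<kappa>ij i j)"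
    and "r = (\<Sum>i<\<rho>. rr i)" and "s = (\<Sum>j<\<sigma>. ss j)"
    and "\<And>n. n \<in> I \<Longrightarrow> A n = level_mat (\<nu> n) r s
           (\<lambda>k l. block_array \<rho> \<sigma> rr ss (\<lambda>i j. level_block (\<nu> n) (rr i) (ss j) (Aij n i j) k l))"
    and "\<And>z. z \<in> symbol_domain \<Longrightarrow> \<kappa> z = block_array \<rho> \<sigma> rr ss (\<lambda>i j. \<kappa>ij i j z)"
    and "\<And>n. n \<in> I \<Longrightarrow> B n =
           block_array \<rho> \<sigma> (\<lambda>i. N_of (\<nu> n) * rr i) (\<lambda>j. N_of (\<nu> n) * ss j) (Aij n)"
  shows "(GLT I \<nu> r s A \<kappa> \<longleftrightarrow>
            (\<forall>i<\<rho>. \<forall>j<\<sigma>. GLT I \<nu> (rr i) (ss j) (\<lambda>n. Aij n i j) (\<kappa>ij i j)))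
         \<and>
         (\<forall>n\<in>I.
            (perm_mat r (N_of (\<nu> n)) *
               diag_block_mat (map (\<lambda>i. transpose_mat (perm_mat (rr i) (N_of (\<nu> n)))) [0..<\<rho>]))
            * B n
            * transpose_mat (perm_mat s (N_of (\<nu> n)) *
               diag_block_mat (map (\<lambda>j. transpose_mat (perm_mat (ss j) (N_of (\<nu> n)))) [0..<\<sigma>]))
            = A n)"
proof (intro conjI ballI)
  show "GLT I \<nu> r s A \<kappa> \<longleftrightarrow>
      (\<forall>i<\<rho>. \<forall>j<\<sigma>. GLT I \<nu> (rr i) (ss j) (\<lambda>n. Aij n i j) (\<kappa>ij i j))"
    by (rule GLT_block_array_iff)
      (use assms in \<open>auto simp: measurable_symbol_def Suc_le_eq\<close>)
next
  fix n assume n: "n \<in> I"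
  show "(perm_mat r (N_of (\<nu> n)) *
          diag_block_mat (map (\<lambda>i. transpose_mat (perm_mat (rr i) (N_of (\<nu> n)))) [0..<\<rho>]))
        * B n
        * transpose_mat (perm_mat s (N_of (\<nu> n)) *
          diag_block_mat (map (\<lambda>j. transpose_mat (perm_mat (ss j) (N_of (\<nu> n)))) [0..<\<sigma>]))
      = A n"
    unfolding assms(11)[OF n] assms(9)[OF n] by (rule permuted_block_array[OF assms(7,8)])
qed

end
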